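(* Let $n\ge 0$ be an integer such that $\operatorname{reg}_{n+1}^R(k)=0$. Then $t_i^S(R)\le 2i$ for all integers $i$ with $0\le i\le n$.
   Context: $k$ is a field and $R=\bigoplus_{i\ge0}R_i$ is a commutative graded $k$-algebra with $R_0=k$, $R=k[R_1]$ and $\operatorname{rank}_kR_1$ finite. $S$ is the symmetric $k$-algebra on $R_1$ (a standard graded polynomial ring), and $S\to R$ is the canonical surjection of graded $k$-algebras. The residue field $k$ is viewed as a module over $R$ and $S$. For a graded vector space $V$, $\operatorname{top}(V)=\sup\{j\mid V_j\ne0\}$ (equal to $-\infty$ if $V=0$). For $A\in\{R,S\}$ and a graded $A$-module $N$, put $t_i^A(N)=\operatorname{top}(\operatorname{Tor}_i^A(k,N))$ and $\operatorname{reg}_n^A(N)=\max_{i\le n}\{t_i^A(N)-i\}$. *)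

theory Defs
  imports
    "HOL-Library.Poly_Mapping"
    "HOL-Library.Extended_Real"
    "HOL-Algebra.Coset"
begin

section \<open>Standard graded algebras\<close>

locale k_algebra = vector_space scale
  for scale :: "'k::field \<Rightarrow> 'a::comm_ring_1 \<Rightarrow> 'a" +
  assumes scale_mult_left: "scale c (x * y) = scale c x * y"

text \<open>
  Gradings are indexed by the integers throughout, so that shifts of graded modules need no
  case distinctions; a grading by the natural numbers is one that vanishes in negative degrees.
\<close>

locale standard_graded_algebra = k_algebra scale
  for scale :: "'k::field \<Rightarrow> 'a::comm_ring_1 \<Rightarrow> 'a" +
  fixes R :: "int \<Rightarrow> 'a set"
  assumes negative: "i < 0 \<Longrightarrow> R i = {0}"
    and subspace_component: "subspace (R i)"
    and mult_component: "x \<in> R i \<Longrightarrow> y \<in> R j \<Longrightarrow> x * y \<in> R (i + j)"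
    and direct_sum: "\<exists>!x :: int \<Rightarrow>\<^sub>0 'a.
          (\<forall>i. Poly_Mapping.lookup x i \<in> R i) \<and>
          a = (\<Sum>i\<in>Poly_Mapping.keys x. Poly_Mapping.lookup x i)"
    and component_0: "R 0 = range (\<lambda>c. scale c 1)"
    and generated: "(\<lambda>T. subspace T \<and> 1 \<in> T \<and> (\<forall>x\<in>T. \<forall>y\<in>T. x * y \<in> T)) hull R 1 = UNIV"
    and finite_rank: "\<exists>X. finite X \<and> span X = R 1"


section \<open>The symmetric algebra on the degree one component\<close>

text \<open>
  If \<open>X\<close> is a basis of \<open>R\<^sub>1\<close>, the symmetric algebra on \<open>R\<^sub>1\<close> is the polynomial ring over \<open>k\<close> in
  one variable for each element of \<open>X\<close>. It lies in the ring of polynomials with variables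
  indexed by the whole type of \<open>R\<close>: only monomials in variables from \<open>X\<close> are admitted.
\<close>

type_synonym ('r, 'k) pol = "('r \<Rightarrow>\<^sub>0 nat) \<Rightarrow>\<^sub>0 'k"

definition sym_scale :: "'k::field \<Rightarrow> ('r, 'k) pol \<Rightarrow> ('r, 'k) pol" where
  "sym_scale c p = Poly_Mapping.single 0 c * p"

definition sym_alg :: "'r set \<Rightarrow> int \<Rightarrow> ('r, 'k::field) pol set" where
  "sym_alg X j =
     {p. \<forall>m\<in>Poly_Mapping.keys p. Poly_Mapping.keys m \<subseteq> X \<and>
          int (\<Sum>x\<in>Poly_Mapping.keys m. Poly_Mapping.lookup m x) = j}"

definition canonical_map ::
    "('k::field \<Rightarrow> 'r::comm_ring_1 \<Rightarrow> 'r) \<Rightarrow> ('r, 'k) pol \<Rightarrow> 'r" where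
  "canonical_map scale p =
     (\<Sum>m\<in>Poly_Mapping.keys p.
        scale (Poly_Mapping.lookup p m) (\<Prod>x\<in>Poly_Mapping.keys m. x ^ Poly_Mapping.lookup m x))"


section \<open>Graded modules\<close>

text \<open>
  A graded ring is given by its family of components inside an ambient ring, a graded module by
  its components inside an ambient abelian group together with the action of ring elements.
\<close>

record ('a, 'n) graded_module =
  comp :: "int \<Rightarrow> 'n set"
  act :: "'a \<Rightarrow> 'n \<Rightarrow> 'n"

definition regular_module :: "(int \<Rightarrow> 'a::comm_ring_1 set) \<Rightarrow> ('a, 'a) graded_module" where
  "regular_module A = \<lparr>comp = A, act = (*)\<rparr>"

definition sym_module ::
    "('k::field \<Rightarrow> 'r::comm_ring_1 \<Rightarrow> 'r) \<Rightarrow> (int \<Rightarrow> 'r set) \<Rightarrow> (('r, 'k) pol, 'r) graded_module" where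
  "sym_module scale R = \<lparr>comp = R, act = (\<lambda>p x. canonical_map scale p * x)\<rparr>"

text \<open>
  The augmentation \<open>A \<rightarrow> A/A\<^sub>+ = k\<close>; it is meaningful on the sum of the components of \<open>A\<close>.
\<close>

definition augmentation ::
    "('k::field \<Rightarrow> 'a::comm_ring_1 \<Rightarrow> 'a) \<Rightarrow> (int \<Rightarrow> 'a set) \<Rightarrow> 'a \<Rightarrow> 'k" where
  "augmentation scale A a = (THE c. a - scale c 1 \<in> module.span scale (\<Union>i\<in>{0<..}. A i))"

definition residue_field ::
    "('k::field \<Rightarrow> 'a::comm_ring_1 \<Rightarrow> 'a) \<Rightarrow> (int \<Rightarrow> 'a set) \<Rightarrow> ('a, 'k) graded_module" where
  "residue_field scale A =
     \<lparr>comp = (\<lambda>j. if j = 0 then UNIV else {0}), act = (\<lambda>a c. augmentation scale A a * c)\<rparr>"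


section \<open>Graded free resolutions of the residue field\<close>

text \<open>
  A complex \<open>\<dots> \<rightarrow> F\<^sub>1 \<rightarrow> F\<^sub>0 \<rightarrow> k\<close> of graded free \<open>A\<close>-modules is given by index sets of homogeneous
  bases, by the degrees of the basis elements, and by the images of the basis elements:
  \<open>diff F i b\<close> is the image in \<open>F\<^sub>i\<close> of the basis element \<open>b\<close> of \<open>F\<^sub>i\<^sub>+\<^sub>1\<close>, and \<open>aug F b\<close> is the
  image in \<open>k\<close> of the basis element \<open>b\<close> of \<open>F\<^sub>0\<close>. Bases may be infinite. Countable index sets
  are enough to resolve \<open>k\<close> over \<open>A\<close> when all components of \<open>A\<close> have finite rank over \<open>k\<close>.
\<close>

record (overloaded) ('a, 'k) free_complex =
  basis :: "nat \<Rightarrow> nat set"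
  deg :: "nat \<Rightarrow> nat \<Rightarrow> int"
  diff :: "nat \<Rightarrow> nat \<Rightarrow> (nat \<Rightarrow>\<^sub>0 'a)"
  aug :: "nat \<Rightarrow> 'k"

text \<open>
  As \<open>F\<^sub>i\<close> is the direct sum of the shifts \<open>A(-deg F i b)\<close>, the module \<open>F\<^sub>i \<otimes>\<^sub>A N\<close> is the direct sum
  of the shifts \<open>N(-deg F i b)\<close>. For \<open>N = A\<close> this is \<open>F\<^sub>i\<close> itself.
\<close>

definition tensor_comp ::
    "('a::zero, 'k) free_complex \<Rightarrow> ('a, 'n::zero) graded_module \<Rightarrow> nat \<Rightarrow> int \<Rightarrow> (nat \<Rightarrow>\<^sub>0 'n) set" where
  "tensor_comp F N i j =
     {f. Poly_Mapping.keys f \<subseteq> basis F i \<and>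
         (\<forall>b\<in>basis F i. Poly_Mapping.lookup f b \<in> comp N (j - deg F i b))}"

definition tensor_diff ::
    "('a::zero, 'k) free_complex \<Rightarrow> ('a, 'n::comm_monoid_add) graded_module
      \<Rightarrow> nat \<Rightarrow> (nat \<Rightarrow>\<^sub>0 'n) \<Rightarrow> (nat \<Rightarrow>\<^sub>0 'n)" where
  "tensor_diff F N i f =
     (\<Sum>b\<in>Poly_Mapping.keys f. \<Sum>c\<in>Poly_Mapping.keys (diff F i b).
        Poly_Mapping.single c (act N (Poly_Mapping.lookup (diff F i b) c) (Poly_Mapping.lookup f b)))"

definition cycles ::
    "('a::zero, 'k) free_complex \<Rightarrow> ('a, 'n::comm_monoid_add) graded_module
      \<Rightarrow> nat \<Rightarrow> int \<Rightarrow> (nat \<Rightarrow>\<^sub>0 'n) set" where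
  "cycles F N i j =
     (case i of 0 \<Rightarrow> tensor_comp F N 0 j
      | Suc i' \<Rightarrow> {f \<in> tensor_comp F N i j. tensor_diff F N i' f = 0})"

definition boundaries ::
    "('a::zero, 'k) free_complex \<Rightarrow> ('a, 'n::comm_monoid_add) graded_module
      \<Rightarrow> nat \<Rightarrow> int \<Rightarrow> (nat \<Rightarrow>\<^sub>0 'n) set" where
  "boundaries F N i j = tensor_diff F N i ` tensor_comp F N (Suc i) j"

definition aug_map ::
    "('k::field \<Rightarrow> 'a::comm_ring_1 \<Rightarrow> 'a) \<Rightarrow> (int \<Rightarrow> 'a set) \<Rightarrow> ('a, 'k) free_complex
      \<Rightarrow> (nat \<Rightarrow>\<^sub>0 'a) \<Rightarrow> 'k" where
  "aug_map scale A F f =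
     (\<Sum>b\<in>Poly_Mapping.keys f. act (residue_field scale A) (Poly_Mapping.lookup f b) (aug F b))"

definition is_free_resolution ::
    "('k::field \<Rightarrow> 'a::comm_ring_1 \<Rightarrow> 'a) \<Rightarrow> (int \<Rightarrow> 'a set) \<Rightarrow> ('a, 'k) free_complex \<Rightarrow> bool" where
  "is_free_resolution scale A F \<longleftrightarrow>
     (\<forall>i. \<forall>b\<in>basis F (Suc i). diff F i b \<in> tensor_comp F (regular_module A) i (deg F (Suc i) b)) \<and>
     (\<forall>b\<in>basis F 0. aug F b \<in> comp (residue_field scale A) (deg F 0 b)) \<and>
     (\<forall>j. aug_map scale A F ` tensor_comp F (regular_module A) 0 j = comp (residue_field scale A) j) \<and>
     (\<forall>j. {f \<in> tensor_comp F (regular_module A) 0 j. aug_map scale A F f = 0}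
            = boundaries F (regular_module A) 0 j) \<and>
     (\<forall>i j. cycles F (regular_module A) (Suc i) j = boundaries F (regular_module A) (Suc i) j)"


section \<open>Tor and regularity\<close>

definition additive_group :: "'n::ab_group_add set \<Rightarrow> 'n monoid" where
  "additive_group Z = \<lparr>carrier = Z, monoid.mult = (+), one = 0\<rparr>"

text \<open>
  \<open>Tor scale A N i j\<close> is the degree \<open>j\<close> component of \<open>Tor\<^sub>i\<^sup>A(k, N)\<close>, computed from a chosen
  graded free resolution of \<open>k\<close> over \<open>A\<close>. Only its additive group is recorded.
\<close>

definition Tor ::
    "('k::field \<Rightarrow> 'a::comm_ring_1 \<Rightarrow> 'a) \<Rightarrow> (int \<Rightarrow> 'a set) \<Rightarrow> ('a, 'n::ab_group_add) graded_module
      \<Rightarrow> nat \<Rightarrow> int \<Rightarrow> (nat \<Rightarrow>\<^sub>0 'n) set monoid" where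
  "Tor scale A N i j =
     (let F = (SOME F. is_free_resolution scale A F)
      in additive_group (cycles F N i j) Mod boundaries F N i j)"

text \<open>The supremum of the empty set of extended reals is \<open>-\<infinity>\<close>.\<close>

definition top_degree :: "(int \<Rightarrow> 'v monoid) \<Rightarrow> ereal" where
  "top_degree V = (SUP j\<in>{j. carrier (V j) \<noteq> {one (V j)}}. ereal (real_of_int j))"

definition t_deg ::
    "('k::field \<Rightarrow> 'a::comm_ring_1 \<Rightarrow> 'a) \<Rightarrow> (int \<Rightarrow> 'a set) \<Rightarrow> ('a, 'n::ab_group_add) graded_module
      \<Rightarrow> nat \<Rightarrow> ereal" where
  "t_deg scale A N i = top_degree (Tor scale A N i)"

definition reg_upto ::
    "('k::field \<Rightarrow> 'a::comm_ring_1 \<Rightarrow> 'a) \<Rightarrow> (int \<Rightarrow> 'a set) \<Rightarrow> nat \<Rightarrow> ('a, 'n::ab_group_add) graded_module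
      \<Rightarrow> ereal" where
  "reg_upto scale A n N = (MAX i\<in>{..n}. t_deg scale A N i - ereal (real i))"

end

theory Submission
  imports Defs "HOL-Library.Countable_Set"
begin

text \<open>
  Let \<open>F\<close> be a graded free resolution of \<open>k\<close> over \<open>S\<close> and let \<open>C = F \<otimes>\<^sub>S R\<close>, a complex of free
  \<open>R\<close>-modules with cycles \<open>Z\<^sub>p\<close>, boundaries \<open>B\<^sub>p\<close> and homology \<open>H\<^sub>p = Z\<^sub>p / B\<^sub>p = Tor\<^sub>p\<^sup>S(k, R)\<close>. The idea
  is to bound the degrees of \<open>H\<^sub>p\<close> and of \<open>Tor\<^sub>m\<^sup>R(k, Z\<^sub>p)\<close> together, by induction on \<open>p\<close>: for \<open>p \<le> n\<close>

    \<^item> \<open>H\<^sub>p\<close> vanishes in degrees above \<open>2p\<close>;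
    \<^item> \<open>Tor\<^sub>m\<^sup>R(k, Z\<^sub>p)\<close> vanishes in degrees above \<open>2p + m\<close>, for \<open>1 \<le> m \<le> n - p\<close>.

  Multiplication by an element of \<open>S\<close> of positive degree is null homotopic on \<open>F\<close>
  (\<open>homotopy_for_positive_degree\<close>), so \<open>R\<^sub>+\<close> kills \<open>H\<^sub>p\<close>, which is therefore a sum of shifts of \<open>k\<close>. The
  hypothesis on \<open>Tor\<^sup>R(k, k)\<close> then puts \<open>Tor\<^sub>m\<^sup>R(k, H\<^sub>p)\<close> in degrees at most \<open>2p + m\<close> for \<open>m \<le> n + 1\<close>
  (\<open>quotient_tor_vanishes\<close>). The long exact sequences of \<open>0 \<rightarrow> B\<^sub>p \<rightarrow> Z\<^sub>p \<rightarrow> H\<^sub>p \<rightarrow> 0\<close> and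
  \<open>0 \<rightarrow> Z\<^sub>p\<^sub>+\<^sub>1 \<rightarrow> C\<^sub>p\<^sub>+\<^sub>1 \<rightarrow> B\<^sub>p \<rightarrow> 0\<close>, where \<open>C\<^sub>p\<^sub>+\<^sub>1\<close> is free, move this bound from \<open>Tor\<^sub>m\<^sub>+\<^sub>2(H\<^sub>p)\<close> to
  \<open>Tor\<^sub>m\<^sub>+\<^sub>1(B\<^sub>p)\<close> and on to \<open>Tor\<^sub>m(Z\<^sub>p\<^sub>+\<^sub>1)\<close> (\<open>submodule_tor_vanishes\<close>, \<open>kernel_boundary\<close>). Lowering the
  homological degree by two is what raises the bound by \<open>2\<close> from \<open>p\<close> to \<open>p + 1\<close>.

  If \<open>F\<close> were minimal, \<open>H\<^sub>p\<^sub>+\<^sub>1\<close> would be bounded by the degrees of the generators of \<open>Z\<^sub>p\<^sub>+\<^sub>1\<close>. But \<open>F\<close> is an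
  arbitrary resolution, whose bases may have elements of any degree. What remains true is that
  \<open>Tor\<^sub>p\<^sup>S(k, k)\<close> is zero in degrees above \<open>p\<close>, which follows by killing the variables of \<open>S\<close>
  one after the other (\<open>variable_quotient_tor_vanishes\<close>). Hence a cycle of degree
  \<open>j > p\<close> is homologous to a cycle \<open>y\<close> that is zero in \<open>k \<otimes> C\<^sub>p\<close>. If in addition \<open>Tor\<^sub>1\<^sup>R(k, B\<^sub>p\<^sub>-\<^sub>1)\<close>
  is zero in degree \<open>j\<close>, then \<open>k \<otimes> Z\<^sub>p \<rightarrow> k \<otimes> C\<^sub>p\<close> is injective in that degree, so that \<open>y \<in> R\<^sub>+ Z\<^sub>p\<close>, and
  \<open>R\<^sub>+ Z\<^sub>p \<subseteq> B\<^sub>p\<close> (\<open>cycle_is_boundary\<close>). The start \<open>p = 0\<close> is the same, with \<open>Z\<^sub>0 = C\<^sub>0\<close>.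

  Since \<open>Tor\<close> is computed from a chosen resolution, all this is about arbitrary resolutions, and the
  existence of at least one over \<open>R\<close> and over \<open>S\<close> has to be established
  (\<open>free_resolution_exists\<close>). A quotient module \<open>N / B\<close> is never formed:
  cycles and boundaries with coefficients in \<open>N / B\<close> are those with coefficients in \<open>N\<close>, up to \<open>B\<close>.
\<close>


section \<open>Finitely supported functions and graded modules\<close>

abbreviation "lookup \<equiv> Poly_Mapping.lookup"
abbreviation "keys \<equiv> Poly_Mapping.keys"
abbreviation "single \<equiv> Poly_Mapping.single"

lemma lookup_map: "f 0 = 0 \<Longrightarrow> lookup (Poly_Mapping.map f p) k = f (lookup p k)"
  by (simp add: map.rep_eq when_def)

lemma lookup_sum_single:
  "finite K \<Longrightarrow> lookup (\<Sum>b\<in>K. single b (v b)) c = (if c \<in> K then v c else 0)"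
  by (simp add: lookup_sum lookup_single when_def)

text \<open>
  The linear extension of \<open>\<phi>\<close>, which is given on a basis, with coefficients in a module with action \<open>s\<close>.
  Differentials, homotopies and their base changes all have this form.
\<close>

definition lin_ext ::
    "('a::zero \<Rightarrow> 'n::zero \<Rightarrow> 'm::comm_monoid_add) \<Rightarrow> ('b \<Rightarrow> 'c \<Rightarrow>\<^sub>0 'a) \<Rightarrow> ('b \<Rightarrow>\<^sub>0 'n) \<Rightarrow> ('c \<Rightarrow>\<^sub>0 'm)" where
  "lin_ext s \<phi> f =
     (\<Sum>b\<in>keys f. \<Sum>c\<in>keys (\<phi> b). single c (s (lookup (\<phi> b) c) (lookup f b)))"

lemma tensor_diff_eq_lin_ext: "tensor_diff F N i = lin_ext (act N) (diff F i)"
  by (simp add: tensor_diff_def lin_ext_def fun_eq_iff)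

lemma lookup_lin_ext:
  assumes "\<And>v. s 0 v = 0"
  shows "lookup (lin_ext s \<phi> f) c = (\<Sum>b\<in>keys f. s (lookup (\<phi> b) c) (lookup f b))"
proof -
  have "(\<Sum>c'\<in>keys (\<phi> b). lookup (single c' (s (lookup (\<phi> b) c') (lookup f b))) c)
      = s (lookup (\<phi> b) c) (lookup f b)" for b
    using assms by (auto simp: lookup_single when_def sum.delta' in_keys_iff)
  then show ?thesis
    by (simp add: lin_ext_def lookup_sum)
qed

context module
begin

lemma lookup_lin_ext_superset:
  assumes "finite I" "keys f \<subseteq> I"
  shows "lookup (lin_ext scale \<phi> f) c = (\<Sum>b\<in>I. scale (lookup (\<phi> b) c) (lookup f b))"
  unfolding lookup_lin_ext[of scale, OF scale_zero_left]
  using assms by (intro sum.mono_neutral_left) (auto simp: in_keys_iff)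

lemma lin_ext_zero [simp]: "lin_ext scale \<phi> 0 = 0"
  by (simp add: lin_ext_def)

lemma lin_ext_add: "lin_ext scale \<phi> (f + g) = lin_ext scale \<phi> f + lin_ext scale \<phi> g"
proof (rule poly_mapping_eqI)
  fix c
  have "keys (f + g) \<subseteq> keys f \<union> keys g" by (rule keys_add)
  then show "lookup (lin_ext scale \<phi> (f + g)) c = lookup (lin_ext scale \<phi> f + lin_ext scale \<phi> g) c"
    by (simp add: lookup_lin_ext_superset[of "keys f \<union> keys g"] lookup_add scale_right_distrib
        sum.distrib)
qed

lemma additive_lin_ext: "additive (lin_ext scale \<phi>)"
  by (simp add: additive_def lin_ext_add)

lemmas lin_ext_diff = additive.diff[OF additive_lin_ext]
lemmas lin_ext_sum = additive.sum[OF additive_lin_ext]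

lemma lookup_lin_ext_single:
  "lookup (lin_ext scale \<phi> (single b v)) c = scale (lookup (\<phi> b) c) v"
  by (subst lookup_lin_ext_superset[of "{b}"]) auto

lemma lin_ext_cong:
  assumes "\<And>b. b \<in> keys f \<Longrightarrow> \<phi> b = \<psi> b"
  shows "lin_ext scale \<phi> f = lin_ext scale \<psi> f"
  using assms by (simp add: lin_ext_def cong: sum.cong)

lemma lin_ext_plus_map:
  "lin_ext scale (\<lambda>b. \<phi> b + \<psi> b) f = lin_ext scale \<phi> f + lin_ext scale \<psi> f"
  by (rule poly_mapping_eqI)
    (simp add: lookup_lin_ext_superset[of "keys f"] lookup_add scale_left_distrib sum.distrib)

lemma lin_ext_zero_map: "lin_ext scale (\<lambda>b. 0) f = 0"
  by (simp add: lin_ext_def)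

lemma lin_ext_single_map:
  "lin_ext scale (\<lambda>b. single b r) f = Poly_Mapping.map (scale r) f"
proof (rule poly_mapping_eqI)
  fix c
  have "lookup (lin_ext scale (\<lambda>b. single b r) f) c
      = (\<Sum>b\<in>insert c (keys f). scale (r when b = c) (lookup f b))"
    by (simp add: lookup_lin_ext_superset[of "insert c (keys f)"] subset_insertI lookup_single)
  also have "\<dots> = scale r (lookup f c)"
    by (subst sum.remove[of _ c]) (auto simp: when_def intro!: sum.neutral)
  finally show "lookup (lin_ext scale (\<lambda>b. single b r) f) c = lookup (Poly_Mapping.map (scale r) f) c"
    by (simp add: lookup_map)
qed

lemma lin_ext_lin_ext:
  "lin_ext scale \<phi> (lin_ext scale \<psi> f) = lin_ext scale (\<lambda>b. lin_ext (*) \<phi> (\<psi> b)) f"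
proof (rule poly_mapping_eqI)
  fix c
  define I where "I = (\<Union>b\<in>keys f. keys (\<psi> b))"
  have fin: "finite I" by (simp add: I_def)
  have sub: "keys (lin_ext scale \<psi> f) \<subseteq> I"
  proof
    fix b assume "b \<in> keys (lin_ext scale \<psi> f)"
    then have "(\<Sum>a\<in>keys f. scale (lookup (\<psi> a) b) (lookup f a)) \<noteq> 0"
      by (simp add: in_keys_iff lookup_lin_ext)
    then obtain a where "a \<in> keys f" "scale (lookup (\<psi> a) b) (lookup f a) \<noteq> 0"
      by (meson sum.neutral)
    then show "b \<in> I" by (auto simp: I_def in_keys_iff intro!: bexI[of _ a])
  qed
  interpret reg: module "(*) :: 'a \<Rightarrow> 'a \<Rightarrow> 'a"
    by standard (auto simp: algebra_simps)
  have "lookup (lin_ext scale \<phi> (lin_ext scale \<psi> f)) c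
      = (\<Sum>b\<in>I. scale (lookup (\<phi> b) c) (\<Sum>a\<in>keys f. scale (lookup (\<psi> a) b) (lookup f a)))"
    by (simp add: lookup_lin_ext_superset[OF fin sub] lookup_lin_ext)
  also have "\<dots> = (\<Sum>a\<in>keys f. scale (\<Sum>b\<in>I. lookup (\<phi> b) c * lookup (\<psi> a) b) (lookup f a))"
    by (simp add: scale_sum_right scale_sum_left) (rule sum.swap)
  also have "\<dots> = (\<Sum>a\<in>keys f. scale (lookup (lin_ext (*) \<phi> (\<psi> a)) c) (lookup f a))"
  proof (rule sum.cong[OF refl])
    fix a assume "a \<in> keys f"
    then have "keys (\<psi> a) \<subseteq> I" by (auto simp: I_def)
    then show "scale (\<Sum>b\<in>I. lookup (\<phi> b) c * lookup (\<psi> a) b) (lookup f a)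
        = scale (lookup (lin_ext (*) \<phi> (\<psi> a)) c) (lookup f a)"
      by (simp add: reg.lookup_lin_ext_superset[OF fin])
  qed
  finally show "lookup (lin_ext scale \<phi> (lin_ext scale \<psi> f)) c
      = lookup (lin_ext scale (\<lambda>b. lin_ext (*) \<phi> (\<psi> b)) f) c"
    by (simp add: lookup_lin_ext)
qed

end

lemma module_times: "module ((*) :: 'a::comm_ring_1 \<Rightarrow> 'a \<Rightarrow> 'a)"
  by standard (auto simp: algebra_simps)

text \<open>
  Naturality in the coefficient module. The rings of the two modules are the same, but one can let it act
  through a ring map, so that this covers change of rings too.
\<close>

lemma lin_ext_natural:
  assumes "module s" "module s'" "additive h" "\<And>a b. b \<in> keys f \<Longrightarrow> h (s a (lookup f b)) = s' a (h (lookup f b))"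
  shows "lin_ext s' \<phi> (Poly_Mapping.map h f) = Poly_Mapping.map h (lin_ext s \<phi> f)"
proof (rule poly_mapping_eqI)
  fix c
  interpret M: module s by fact
  interpret M': module s' by fact
  interpret h: additive h by fact
  have "keys (Poly_Mapping.map h f) \<subseteq> keys f"
    by (auto simp: in_keys_iff lookup_map h.zero)
  then show "lookup (lin_ext s' \<phi> (Poly_Mapping.map h f)) c = lookup (Poly_Mapping.map h (lin_ext s \<phi> f)) c"
    by (subst M'.lookup_lin_ext_superset[of "keys f"])
      (simp_all add: lookup_map h.zero lookup_lin_ext h.sum assms(4))
qed

text \<open>
  Linearity over \<open>k\<close> does not appear on its own: it is the action of the degree \<open>0\<close> component.
\<close>

definition graded_submodule :: "(int \<Rightarrow> 'a set) \<Rightarrow> ('a \<Rightarrow> 'n::ab_group_add \<Rightarrow> 'n) \<Rightarrow> (int \<Rightarrow> 'n set) \<Rightarrow> bool" where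
  "graded_submodule A s N \<longleftrightarrow>
     (\<forall>j. 0 \<in> N j \<and> (\<forall>u\<in>N j. \<forall>v\<in>N j. u - v \<in> N j)) \<and>
     (\<forall>i j. \<forall>a\<in>A i. \<forall>v\<in>N j. s a v \<in> N (i + j))"

lemma graded_submoduleI:
  assumes "\<And>j. 0 \<in> N j" "\<And>j u v. u \<in> N j \<Longrightarrow> v \<in> N j \<Longrightarrow> u - v \<in> N j"
    "\<And>i j a v. a \<in> A i \<Longrightarrow> v \<in> N j \<Longrightarrow> s a v \<in> N (i + j)"
  shows "graded_submodule A s N"
  using assms by (simp add: graded_submodule_def)

lemma
  assumes "graded_submodule A s N"
  shows graded_submodule_zero: "0 \<in> N j"
    and graded_submodule_diff: "u \<in> N j \<Longrightarrow> v \<in> N j \<Longrightarrow> u - v \<in> N j"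
    and graded_submodule_act: "a \<in> A i \<Longrightarrow> v \<in> N j \<Longrightarrow> l = i + j \<Longrightarrow> s a v \<in> N l"
  using assms by (auto simp: graded_submodule_def)

lemma graded_submodule_minus:
  "graded_submodule A s N \<Longrightarrow> u \<in> N j \<Longrightarrow> - u \<in> N j"
  using graded_submodule_diff[of A s N 0 j u] graded_submodule_zero[of A s N j] by simp

lemma graded_submodule_add:
  "graded_submodule A s N \<Longrightarrow> u \<in> N j \<Longrightarrow> v \<in> N j \<Longrightarrow> u + v \<in> N j"
  using graded_submodule_diff[of A s N u j "- v"] graded_submodule_minus[of A s N v j] by simp

lemma graded_submodule_sum:
  "graded_submodule A s N \<Longrightarrow> (\<And>x. x \<in> I \<Longrightarrow> f x \<in> N j) \<Longrightarrow> sum f I \<in> N j"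
  by (induction I rule: infinite_finite_induct)
    (auto simp: graded_submodule_zero graded_submodule_add)

text \<open>The degree \<open>j\<close> component of the direct sum of the shifts \<open>N(-\<delta> b)\<close>, for \<open>b \<in> I\<close>.\<close>

definition shift_sum :: "nat set \<Rightarrow> (nat \<Rightarrow> int) \<Rightarrow> (int \<Rightarrow> 'n::zero set) \<Rightarrow> int \<Rightarrow> (nat \<Rightarrow>\<^sub>0 'n) set" where
  "shift_sum I \<delta> N j = {f. keys f \<subseteq> I \<and> (\<forall>b\<in>I. lookup f b \<in> N (j - \<delta> b))}"

lemma tensor_comp_eq_shift_sum: "tensor_comp F N i = shift_sum (basis F i) (deg F i) (comp N)"
  by (simp add: tensor_comp_def shift_sum_def fun_eq_iff)

lemma shift_sumI:
  "(\<And>b. b \<notin> I \<Longrightarrow> lookup f b = 0) \<Longrightarrow> (\<And>b. b \<in> I \<Longrightarrow> lookup f b \<in> N (j - \<delta> b)) \<Longrightarrow> f \<in> shift_sum I \<delta> N j"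
  by (auto simp: shift_sum_def in_keys_iff)

lemma shift_sumD:
  assumes "f \<in> shift_sum I \<delta> N j"
  shows "b \<in> keys f \<Longrightarrow> b \<in> I" "b \<in> I \<Longrightarrow> lookup f b \<in> N (j - \<delta> b)" "b \<notin> I \<Longrightarrow> lookup f b = 0"
  using assms by (auto simp: shift_sum_def in_keys_iff)

lemma shift_sum_lookup:
  assumes "f \<in> shift_sum I \<delta> N j" "\<And>j. 0 \<in> N j" shows "lookup f b \<in> N (j - \<delta> b)"
  using assms by (cases "b \<in> I") (auto simp: shift_sumD)

lemma shift_sum_mono:
  "(\<And>l. N l \<subseteq> N' l) \<Longrightarrow> shift_sum I \<delta> N j \<subseteq> shift_sum I \<delta> N' j"
  by (auto simp: shift_sum_def)

lemma graded_submodule_shift_sum: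
  assumes "graded_submodule A s N" "module s"
  shows "graded_submodule A (\<lambda>a. Poly_Mapping.map (s a)) (shift_sum I \<delta> N)"
proof -
  interpret module s by fact
  note N = assms(1)
  show ?thesis
  proof (rule graded_submoduleI)
    fix i j a v assume a: "a \<in> A i" and v: "v \<in> shift_sum I \<delta> N j"
    show "Poly_Mapping.map (s a) v \<in> shift_sum I \<delta> N (i + j)"
      using shift_sumD(2,3)[OF v]
      by (intro shift_sumI) (auto simp: lookup_map intro!: graded_submodule_act[OF N a])
  qed (auto intro!: shift_sumI simp: lookup_minus graded_submodule_zero[OF N] graded_submodule_diff[OF N] shift_sumD)
qed

lemma single_in_shift_sum:
  assumes "b \<in> I" "v \<in> N l" "j = l + \<delta> b" "\<And>j. 0 \<in> N j"
  shows "single b v \<in> shift_sum I \<delta> N j"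
  using assms by (auto intro!: shift_sumI simp: lookup_single when_def)

lemma lin_ext_in_shift_sum:
  assumes N: "graded_submodule A s N" and s: "module s"
    and \<phi>: "\<And>b. b \<in> I \<Longrightarrow> \<phi> b \<in> shift_sum J \<epsilon> A (\<delta> b + d)"
    and f: "f \<in> shift_sum I \<delta> N j" and l: "l = j + d"
  shows "lin_ext s \<phi> f \<in> shift_sum J \<epsilon> N l"
proof (rule shift_sumI)
  interpret module s by fact
  fix c
  {
    assume "c \<notin> J"
    then have "lookup (\<phi> b) c = 0" if "b \<in> keys f" for b
      using shift_sumD(3)[OF \<phi>] shift_sumD(1)[OF f] that by blast
    then show "lookup (lin_ext s \<phi> f) c = 0"
      by (simp add: lookup_lin_ext)
  next
    assume c: "c \<in> J"
    show "lookup (lin_ext s \<phi> f) c \<in> N (l - \<epsilon> c)"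
      unfolding lookup_lin_ext[of s, OF scale_zero_left]
    proof (rule graded_submodule_sum[OF N])
      fix b assume "b \<in> keys f"
      then have "b \<in> I" using shift_sumD[OF f] by blast
      then show "s (lookup (\<phi> b) c) (lookup f b) \<in> N (l - \<epsilon> c)"
        using shift_sumD(2)[OF \<phi> c] shift_sumD(2)[OF f] l
        by (intro graded_submodule_act[OF N, of _ "\<delta> b + d - \<epsilon> c" _ "j - \<delta> b"]) auto
    qed
  }
qed

text \<open>
  The tensor product with a free module preserves surjections: the coefficients can be lifted one by one.
\<close>

lemma shift_sum_lift:
  fixes h :: "'n::comm_monoid_add \<Rightarrow> 'm::zero"
  assumes f: "f \<in> shift_sum I \<delta> N' j" and N': "\<And>l. N' l \<subseteq> h ` N l"
    and N0: "\<And>l. 0 \<in> N l" and h: "h 0 = 0"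
  shows "\<exists>g\<in>shift_sum I \<delta> N j. Poly_Mapping.map h g = f"
proof -
  have "\<forall>b. \<exists>v. b \<in> keys f \<longrightarrow> v \<in> N (j - \<delta> b) \<and> h v = lookup f b"
    using shift_sumD[OF f] N' by (metis imageE subset_iff)
  then obtain v where v: "\<And>b. b \<in> keys f \<Longrightarrow> v b \<in> N (j - \<delta> b) \<and> h (v b) = lookup f b"
    by metis
  define g where "g = (\<Sum>b\<in>keys f. single b (v b))"
  have g: "lookup g b = (if b \<in> keys f then v b else 0)" for b
    by (simp add: g_def lookup_sum_single)
  show ?thesis
  proof
    show "g \<in> shift_sum I \<delta> N j"
      using shift_sumD(1)[OF f] by (intro shift_sumI) (auto simp: g v N0)
    show "Poly_Mapping.map h g = f"
      by (rule poly_mapping_eqI) (auto simp: lookup_map h g v in_keys_iff)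
  qed
qed

lemma module_pointwise:
  assumes "module s" shows "module (\<lambda>a. Poly_Mapping.map (s a))"
proof -
  interpret module s by fact
  show ?thesis
    by standard (auto intro!: poly_mapping_eqI simp: lookup_map lookup_add scale_right_distrib scale_left_distrib)
qed

section \<open>Connected graded algebras\<close>

text \<open>
  The properties of \<open>R\<close> and \<open>S\<close> needed to resolve \<open>k\<close>. Components of \<open>S\<close> do not span
  the ring in which they lie, so there is no decomposition of arbitrary elements; that \<open>k\<close> meets the span of
  the positive components trivially is what makes the augmentation well defined.
\<close>

locale connected_algebra = k_algebra scale
  for scale :: "'k::field \<Rightarrow> 'a::comm_ring_1 \<Rightarrow> 'a" +
  fixes A :: "int \<Rightarrow> 'a set"
  assumes comp_negative: "i < 0 \<Longrightarrow> A i = {0}"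
    and comp_subspace: "subspace (A i)"
    and comp_times: "x \<in> A i \<Longrightarrow> y \<in> A j \<Longrightarrow> x * y \<in> A (i + j)"
    and comp_zero: "A 0 = range (\<lambda>c. scale c 1)"
    and scalar_in_positive_span: "scale c 1 \<in> span (\<Union>i\<in>{0<..}. A i) \<Longrightarrow> c = 0"
    and comp_finite_rank: "\<exists>X. finite X \<and> A i \<subseteq> span X"
begin

lemma graded_submodule_self: "graded_submodule A (*) A"
  by (intro graded_submoduleI) (auto simp: comp_times subspace_0 subspace_diff comp_subspace)

lemmas comp_has_zero = graded_submodule_zero[OF graded_submodule_self]

lemma scalar_in_comp_zero: "scale c 1 \<in> A 0"
  by (simp add: comp_zero)

lemma one_in_comp_zero: "1 \<in> A 0"
  using scalar_in_comp_zero[of 1] by simp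

lemma scale_eq_times: "scale c 1 * x = scale c x"
  by (metis scale_mult_left mult_1)

lemma scalar_mult: "scale c 1 * scale e 1 = scale (c * e) 1"
  by (simp add: scale_eq_times)

lemma augmentation_eqI:
  assumes "a - scale c 1 \<in> span (\<Union>i\<in>{0<..}. A i)"
  shows "augmentation scale A a = c"
  unfolding augmentation_def
proof (rule the_equality)
  fix c' assume "a - scale c' 1 \<in> span (\<Union>i\<in>{0<..}. A i)"
  from span_diff[OF this assms] have "scale (c - c') 1 \<in> span (\<Union>i\<in>{0<..}. A i)"
    by (simp add: scale_left_diff_distrib)
  then show "c' = c" using scalar_in_positive_span by force
qed fact

lemma augmentation_scalar [simp]: "augmentation scale A (scale c 1) = c"
  by (rule augmentation_eqI) (simp add: span_zero)

lemma augmentation_zero [simp]: "augmentation scale A 0 = 0"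
  using augmentation_scalar[of 0] by simp

lemma augmentation_nonzero_degree:
  assumes "a \<in> A i" "i \<noteq> 0" shows "augmentation scale A a = 0"
proof (cases "i < 0")
  case True then show ?thesis using assms comp_negative by auto
next
  case False with assms have "a \<in> (\<Union>i\<in>{0<..}. A i)" by (intro UN_I[of i]) auto
  then show ?thesis by (intro augmentation_eqI) (simp add: span_base)
qed

lemma comp_zero_eq_augmentation: "a \<in> A 0 \<Longrightarrow> a = scale (augmentation scale A a) 1"
  by (auto simp: comp_zero)

end

section \<open>Free resolutions of the residue field\<close>

text \<open>
  Below, \<open>tc N i j\<close> is the degree \<open>j\<close> component of \<open>F\<^sub>i \<otimes> N\<close> and \<open>d s i\<close> is the differential
  \<open>F\<^sub>i\<^sub>+\<^sub>1 \<otimes> N \<rightarrow> F\<^sub>i \<otimes> N\<close>, where \<open>s\<close> is the action on \<open>N\<close>.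
\<close>

locale resolved_algebra = connected_algebra scale A
  for scale :: "'k::field \<Rightarrow> 'a::comm_ring_1 \<Rightarrow> 'a" and A +
  fixes F :: "('a, 'k) free_complex"
  assumes resolution: "is_free_resolution scale A F"
begin

abbreviation "tc N i \<equiv> shift_sum (basis F i) (deg F i) N"
abbreviation "d s i \<equiv> lin_ext s (diff F i)"

lemma regular_module_simps [simp]:
  "comp (regular_module A) = A" "act (regular_module A) = (*)"
  by (simp_all add: regular_module_def)

lemma diff_in: "b \<in> basis F (Suc i) \<Longrightarrow> diff F i b \<in> tc A i (deg F (Suc i) b)"
  using resolution by (simp add: is_free_resolution_def tensor_comp_eq_shift_sum)

lemma aug_nonzero_degree: "b \<in> basis F 0 \<Longrightarrow> deg F 0 b \<noteq> 0 \<Longrightarrow> aug F b = 0"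
  using resolution by (auto simp: is_free_resolution_def residue_field_def split: if_splits)

lemma exact_Suc:
  assumes "f \<in> tc A (Suc i) j" "d (*) i f = 0"
  shows "\<exists>g\<in>tc A (Suc (Suc i)) j. d (*) (Suc i) g = f"
proof -
  have "cycles F (regular_module A) (Suc i) j = boundaries F (regular_module A) (Suc i) j"
    using resolution by (simp add: is_free_resolution_def)
  moreover have "f \<in> cycles F (regular_module A) (Suc i) j"
    using assms by (simp add: cycles_def tensor_comp_eq_shift_sum tensor_diff_eq_lin_ext)
  ultimately show ?thesis
    by (auto simp: boundaries_def tensor_comp_eq_shift_sum tensor_diff_eq_lin_ext)
qed

lemma d_d_free:
  assumes "f \<in> tc A (Suc (Suc i)) j"
  shows "d (*) i (d (*) (Suc i) f) = 0"
proof -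
  have "cycles F (regular_module A) (Suc i) j = boundaries F (regular_module A) (Suc i) j"
    using resolution by (simp add: is_free_resolution_def)
  moreover have "d (*) (Suc i) f \<in> boundaries F (regular_module A) (Suc i) j"
    using assms by (simp add: boundaries_def tensor_comp_eq_shift_sum tensor_diff_eq_lin_ext)
  ultimately show ?thesis
    by (auto simp: cycles_def tensor_comp_eq_shift_sum tensor_diff_eq_lin_ext)
qed

lemma aug_map_eq: "aug_map scale A F f = (\<Sum>b\<in>keys f. augmentation scale A (lookup f b) * aug F b)"
  by (simp add: aug_map_def residue_field_def)

lemma aug_exact:
  "{f \<in> tc A 0 j. aug_map scale A F f = 0} = d (*) 0 ` tc A (Suc 0) j"
proof -
  have "{f \<in> tensor_comp F (regular_module A) 0 j. aug_map scale A F f = 0}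
            = boundaries F (regular_module A) 0 j"
    using resolution by (simp add: is_free_resolution_def)
  then show ?thesis by (simp add: boundaries_def tensor_comp_eq_shift_sum tensor_diff_eq_lin_ext)
qed

text \<open>The target \<open>k\<close> lives in degree \<open>0\<close>.\<close>

lemma aug_map_nonzero_degree:
  assumes "f \<in> tc A 0 j" "j \<noteq> 0" shows "aug_map scale A F f = 0"
  unfolding aug_map_eq
proof (rule sum.neutral, rule ballI)
  fix b assume "b \<in> keys f"
  with assms(1) have b: "b \<in> basis F 0" "lookup f b \<in> A (j - deg F 0 b)"
    by (auto dest: shift_sumD)
  then show "augmentation scale A (lookup f b) * aug F b = 0"
    using aug_nonzero_degree[of b] augmentation_nonzero_degree[OF b(2)] assms(2) by fastforce
qed

lemma aug_map_surj: "\<exists>e\<in>tc A 0 0. aug_map scale A F e = 1"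
proof -
  have "aug_map scale A F ` tc A 0 0 = UNIV"
    using resolution by (simp add: is_free_resolution_def residue_field_def tensor_comp_eq_shift_sum)
  then show ?thesis by (metis UNIV_I imageE)
qed

lemma single_one_in: "b \<in> basis F i \<Longrightarrow> single b 1 \<in> tc A i (deg F i b)"
  by (rule single_in_shift_sum[of _ _ _ _ 0]) (auto simp: one_in_comp_zero comp_has_zero)

lemma d_single_one: "d (*) i (single b 1) = diff F i b"
proof -
  interpret reg: module "(*) :: 'a \<Rightarrow> 'a \<Rightarrow> 'a" by (rule module_times)
  show ?thesis by (rule poly_mapping_eqI) (simp add: reg.lookup_lin_ext_single)
qed

lemma d_diff: "b \<in> basis F (Suc (Suc i)) \<Longrightarrow> d (*) i (diff F (Suc i) b) = 0"
  using d_d_free[OF single_one_in, of b i] by (simp add: d_single_one)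

lemma aug_diff:
  assumes "b \<in> basis F (Suc 0)" shows "aug_map scale A F (diff F 0 b) = 0"
proof -
  have "diff F 0 b \<in> d (*) 0 ` tc A (Suc 0) (deg F (Suc 0) b)"
    using single_one_in[OF assms] d_single_one[of 0 b] by (metis imageI)
  then show ?thesis unfolding aug_exact[symmetric] by simp
qed

end

locale tensored_resolution = resolved_algebra scale A F + N: module s
  for scale :: "'k::field \<Rightarrow> 'a::comm_ring_1 \<Rightarrow> 'a" and A F
    and s :: "'a \<Rightarrow> 'n::ab_group_add \<Rightarrow> 'n"
begin

lemma d_in:
  assumes "graded_submodule A s N" "f \<in> tc N (Suc i) j" shows "d s i f \<in> tc N i j"
  using assms diff_in
  by (intro lin_ext_in_shift_sum[of A s N "basis F (Suc i)" _ _ _ "deg F (Suc i)" 0])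
     (auto simp: N.module_axioms)

lemma d_d:
  assumes "f \<in> tc N (Suc (Suc i)) j" shows "d s i (d s (Suc i) f) = 0"
proof -
  have "d s i (d s (Suc i) f) = lin_ext s (\<lambda>b. d (*) i (diff F (Suc i) b)) f"
    by (rule N.lin_ext_lin_ext)
  also have "\<dots> = lin_ext s (\<lambda>b. 0) f"
    using shift_sumD(1)[OF assms] by (intro N.lin_ext_cong d_diff)
  finally show ?thesis by (simp add: N.lin_ext_zero_map)
qed

lemma graded_submodule_tc:
  "graded_submodule A s N \<Longrightarrow> graded_submodule A (\<lambda>a. Poly_Mapping.map (s a)) (tc N i)"
  by (rule graded_submodule_shift_sum[OF _ N.module_axioms])

text \<open>
  The part of the long exact sequence of \<open>0 \<rightarrow> ker h \<rightarrow> N \<rightarrow> N' \<rightarrow> 0\<close> around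
  \<open>Tor\<^sub>m\<^sub>+\<^sub>1(N') \<rightarrow> Tor\<^sub>m(ker h) \<rightarrow> Tor\<^sub>m(N)\<close>: if the first group vanishes, then the second map is injective.
  The chain \<open>u\<close> can be corrected by a lift of a chain that bounds \<open>h u\<close>.
\<close>

lemma kernel_boundary:
  assumes s': "module s'" and N: "graded_submodule A s N" and h: "additive h"
    and hs: "\<And>a v. h (s a v) = s' a (h v)" and N': "\<And>l. N' l = h ` N l"
    and tor: "\<And>v. v \<in> tc N' (Suc m) j \<Longrightarrow> d s' m v = 0 \<Longrightarrow> \<exists>w\<in>tc N' (Suc (Suc m)) j. d s' (Suc m) w = v"
    and u: "u \<in> tc N (Suc m) j" and du: "Poly_Mapping.map h (d s m u) = 0"
  shows "\<exists>g\<in>tc (\<lambda>l. {v \<in> N l. h v = 0}) (Suc m) j. d s m g = d s m u"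
proof -
  interpret h: additive h by fact
  note nat = lin_ext_natural[OF N.module_axioms s' h hs]
  have hu: "Poly_Mapping.map h u \<in> tc N' (Suc m) j"
    using u by (auto intro!: shift_sumI simp: lookup_map h.zero N' dest: shift_sumD)
  moreover have "d s' m (Poly_Mapping.map h u) = 0"
    using du by (simp add: nat)
  ultimately obtain w where w: "w \<in> tc N' (Suc (Suc m)) j" "d s' (Suc m) w = Poly_Mapping.map h u"
    using tor by blast
  obtain v where v: "v \<in> tc N (Suc (Suc m)) j" "Poly_Mapping.map h v = w"
    using shift_sum_lift[OF w(1), of h N] N' graded_submodule_zero[OF N] h.zero by auto
  define g where "g = u - d s (Suc m) v"
  have g: "g \<in> tc N (Suc m) j"
    using graded_submodule_diff[OF graded_submodule_tc[OF N] u d_in[OF N v(1)]] by (simp add: g_def)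
  have hg: "h (lookup g b) = 0" for b
  proof -
    have "Poly_Mapping.map h (d s (Suc m) v) = Poly_Mapping.map h u"
      using w(2) v(2) by (simp add: nat[symmetric])
    then have "h (lookup (d s (Suc m) v) b) = h (lookup u b)"
      by (metis lookup_map h.zero)
    then show ?thesis by (simp add: g_def lookup_minus h.diff)
  qed
  show ?thesis
  proof
    show "g \<in> tc (\<lambda>l. {v \<in> N l. h v = 0}) (Suc m) j"
      using g hg by (auto simp: shift_sum_def)
    show "d s m g = d s m u"
      by (simp add: g_def N.lin_ext_diff d_d[OF v(1)])
  qed
qed

text \<open>
  The same for \<open>0 \<rightarrow> B \<rightarrow> N \<rightarrow> N / B \<rightarrow> 0\<close>, with \<open>Tor\<^sub>m\<^sub>+\<^sub>1(N) = 0\<close> as well. The premise \<open>rel\<close> says that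
  \<open>Tor\<^sub>m\<^sub>+\<^sub>2(N / B)\<close> is zero.
\<close>

lemma submodule_tor_vanishes:
  assumes N: "graded_submodule A s N" and B: "graded_submodule A s B" and BN: "\<And>l. B l \<subseteq> N l"
    and tor: "\<And>f. f \<in> tc N (Suc m) j \<Longrightarrow> d s m f = 0 \<Longrightarrow> \<exists>g\<in>tc N (Suc (Suc m)) j. d s (Suc m) g = f"
    and rel: "\<And>f. f \<in> tc N (Suc (Suc m)) j \<Longrightarrow> d s (Suc m) f \<in> tc B (Suc m) j \<Longrightarrow>
        \<exists>g\<in>tc N (Suc (Suc (Suc m))) j. f - d s (Suc (Suc m)) g \<in> tc B (Suc (Suc m)) j"
    and f: "f \<in> tc B (Suc m) j" "d s m f = 0"
  shows "\<exists>g\<in>tc B (Suc (Suc m)) j. d s (Suc m) g = f"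
proof -
  have "f \<in> tc N (Suc m) j" using shift_sum_mono[of B N, OF BN] f(1) by blast
  then obtain u where u: "u \<in> tc N (Suc (Suc m)) j" "d s (Suc m) u = f" using tor f(2) by blast
  then obtain g where g: "g \<in> tc N (Suc (Suc (Suc m))) j"
      "u - d s (Suc (Suc m)) g \<in> tc B (Suc (Suc m)) j"
    using rel f(1) by blast
  show ?thesis
    by (rule bexI[OF _ g(2)]) (simp add: N.lin_ext_diff u(2) d_d[OF g(1)])
qed

text \<open>
  The augmentation induces \<open>Tor\<^sub>0(k, N) \<cong> N / A\<^sub>+ N\<close>. Thus an element \<open>z\<close> whose class \<open>e \<otimes> z\<close> is a boundary
  lies in \<open>A\<^sub>+ N\<close>, hence in any submodule \<open>B\<close> that contains \<open>A\<^sub>+ N\<close>. To see this, apply the map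
  \<open>b \<otimes> v \<mapsto> aug b \<cdot> v\<close>: it sends \<open>e \<otimes> z\<close> to \<open>z\<close> itself, and boundaries into \<open>A\<^sub>+ N\<close>.
\<close>

lemma augmented_boundary:
  assumes N: "graded_submodule A s N" and B: "graded_submodule A s B"
    and triv: "\<And>i l a v. a \<in> A i \<Longrightarrow> 0 < i \<Longrightarrow> v \<in> N l \<Longrightarrow> s a v \<in> B (i + l)"
    and z: "z \<in> N j" and e: "e \<in> tc A 0 0" "aug_map scale A F e = 1"
    and g: "g \<in> tc N (Suc 0) j" "d s 0 g = Poly_Mapping.map (\<lambda>a. s a z) e"
  shows "z \<in> B j"
proof -
  define c where "c b = scale (aug F b) 1" for b
  define K where "K = keys e \<union> (\<Union>b\<in>keys g. keys (diff F 0 b))"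
  have K: "finite K" by (simp add: K_def)
  have scalars: "scale (aug F b) 1 * a = scale (augmentation scale A a * aug F b) 1"
    if "b \<in> basis F 0" "a \<in> A (- deg F 0 b)" for a b
  proof (cases "deg F 0 b = 0")
    case True
    then have "a = scale (augmentation scale A a) 1"
      using that by (intro comp_zero_eq_augmentation) auto
    then have "scale (aug F b) 1 * a = scale (aug F b) 1 * scale (augmentation scale A a) 1"
      by simp
    then show ?thesis by (simp add: scalar_mult mult.commute del: scale_scale)
  qed (simp add: aug_nonzero_degree that)
  have eq: "s (c b) (\<Sum>b'\<in>keys g. s (lookup (diff F 0 b') b) (lookup g b')) = s (c b * lookup e b) z" for b
  proof -
    have "lookup (d s 0 g) b = s (lookup e b) z"
      using g(2) by (simp add: lookup_map)
    then show ?thesis by (simp add: lookup_lin_ext)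
  qed
  have "(\<Sum>b\<in>K. c b * lookup e b) = (\<Sum>b\<in>keys e. c b * lookup e b)"
    using K by (intro sum.mono_neutral_right) (auto simp: K_def in_keys_iff)
  also have "\<dots> = (\<Sum>b\<in>keys e. scale (augmentation scale A (lookup e b) * aug F b) 1)"
    using shift_sumD[OF e(1)] unfolding c_def by (intro sum.cong refl scalars) auto
  also have "\<dots> = scale (aug_map scale A F e) 1"
    by (simp add: aug_map_eq scale_sum_left)
  finally have one: "(\<Sum>b\<in>K. c b * lookup e b) = 1" using e(2) by simp
  have "z = (\<Sum>b\<in>K. s (c b) (\<Sum>b'\<in>keys g. s (lookup (diff F 0 b') b) (lookup g b')))"
    unfolding eq N.scale_sum_left[symmetric] one by simp
  also have "\<dots> = (\<Sum>b'\<in>keys g. s (\<Sum>b\<in>K. c b * lookup (diff F 0 b') b) (lookup g b'))"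
    by (simp add: N.scale_sum_right N.scale_sum_left) (rule sum.swap)
  also have "\<dots> \<in> B j"
  proof (rule graded_submodule_sum[OF B])
    fix b' assume b'k: "b' \<in> keys g"
    then have b': "b' \<in> basis F (Suc 0)" "lookup g b' \<in> N (j - deg F (Suc 0) b')"
      using shift_sumD[OF g(1)] by auto
    \<comment> \<open>The image under the augmentation of the differential of \<open>b'\<close>; as the augmentation kills it,
        the part of degree \<open>0\<close> is zero.\<close>
    define r where "r = (\<Sum>b\<in>K. c b * lookup (diff F 0 b') b)"
    have r_eq: "r = (\<Sum>b\<in>keys (diff F 0 b'). c b * lookup (diff F 0 b') b)"
      unfolding r_def using K b'k by (intro sum.mono_neutral_right) (auto simp: K_def in_keys_iff)
    have r_in: "r \<in> A (deg F (Suc 0) b')"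
      unfolding r_eq
    proof (rule graded_submodule_sum[OF graded_submodule_self])
      fix b assume "b \<in> keys (diff F 0 b')"
      then have b: "b \<in> basis F 0" "lookup (diff F 0 b') b \<in> A (deg F (Suc 0) b' - deg F 0 b)"
        using shift_sumD[OF diff_in[OF b'(1)]] by auto
      show "c b * lookup (diff F 0 b') b \<in> A (deg F (Suc 0) b')"
        using comp_times[OF scalar_in_comp_zero b(2)] aug_nonzero_degree[OF b(1)]
        by (cases "deg F 0 b = 0") (auto simp: c_def comp_has_zero)
    qed
    have "s r (lookup g b') \<in> B j"
    proof (cases "deg F (Suc 0) b'" "0 :: int" rule: linorder_cases)
      case less
      then have "r = 0" using r_in comp_negative by auto
      then show ?thesis by (simp add: graded_submodule_zero[OF B])
    next
      case equal
      have "r = (\<Sum>b\<in>keys (diff F 0 b'). scale (augmentation scale A (lookup (diff F 0 b') b) * aug F b) 1)"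
        using shift_sumD[OF diff_in[OF b'(1)]] equal unfolding c_def r_eq
        by (intro sum.cong refl scalars) auto
      also have "\<dots> = scale (aug_map scale A F (diff F 0 b')) 1"
        by (simp add: aug_map_eq scale_sum_left)
      finally have "r = 0" by (simp add: aug_diff[OF b'(1)])
      then show ?thesis by (simp add: graded_submodule_zero[OF B])
    next
      case greater
      then show ?thesis using triv[OF r_in _ b'(2)] by simp
    qed
    then show "s (\<Sum>b\<in>K. c b * lookup (diff F 0 b') b) (lookup g b') \<in> B j"
      by (simp add: r_def)
  qed
  finally show ?thesis .
qed

end

section \<open>Free coefficients and null homotopies\<close>

context resolved_algebra
begin

abbreviation "smul \<equiv> (\<lambda>a :: 'a. Poly_Mapping.map ((*) a) :: (nat \<Rightarrow>\<^sub>0 'a) \<Rightarrow> (nat \<Rightarrow>\<^sub>0 'a))"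

text \<open>
  With coefficients in a free module, the complex is a direct sum of shifted copies of \<open>F\<close>, one for every basis element of
  the coefficient module. So it can be tested on coordinates whether a chain is a boundary.
\<close>

lemma boundary_of_coordinates:
  assumes f: "f \<in> tc (shift_sum J \<epsilon> A) m j"
    and coord: "\<And>c. c \<in> J \<Longrightarrow> \<exists>g\<in>tc A (Suc m) (j - \<epsilon> c). d (*) m g = Poly_Mapping.map (\<lambda>v. lookup v c) f"
  shows "\<exists>g\<in>tc (shift_sum J \<epsilon> A) (Suc m) j. d smul m g = f"
proof -
  interpret C: module smul by (intro module_pointwise module_times)
  define K where "K = (\<Union>b\<in>keys f. keys (lookup f b))"
  have KJ: "K \<subseteq> J" using shift_sumD[OF f] by (auto simp: K_def dest: shift_sumD(1))
  from coord obtain g where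
    g: "\<And>c. c \<in> J \<Longrightarrow> g c \<in> tc A (Suc m) (j - \<epsilon> c) \<and> d (*) m (g c) = Poly_Mapping.map (\<lambda>v. lookup v c) f"
    by metis
  define h where "h = (\<Sum>c\<in>K. Poly_Mapping.map (single c) (g c))"
  have C: "graded_submodule A smul (shift_sum J \<epsilon> A)"
    by (intro graded_submodule_shift_sum graded_submodule_self module_times)
  have "Poly_Mapping.map (single c) (g c) \<in> tc (shift_sum J \<epsilon> A) (Suc m) j" if "c \<in> K" for c
  proof -
    have c: "c \<in> J" using that KJ by blast
    note gc = shift_sumD[OF conjunct1[OF g[OF c]]]
    have "single c (lookup (g c) b) \<in> shift_sum J \<epsilon> A (j - deg F (Suc m) b)"
      if "b \<in> basis F (Suc m)" for b
      by (rule single_in_shift_sum[where l="j - \<epsilon> c - deg F (Suc m) b"])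
        (auto simp: comp_has_zero c gc(2)[OF that])
    then show ?thesis
      using gc(3) by (intro shift_sumI[where I="basis F (Suc m)"]) (simp_all add: lookup_map)
  qed
  then have h: "h \<in> tc (shift_sum J \<epsilon> A) (Suc m) j"
    unfolding h_def
    by (intro graded_submodule_sum[OF graded_submodule_shift_sum[OF C C.module_axioms]])
  have "d smul m h = (\<Sum>c\<in>K. d smul m (Poly_Mapping.map (single c) (g c)))"
    by (simp add: h_def C.lin_ext_sum)
  also have "\<dots> = (\<Sum>c\<in>K. Poly_Mapping.map (single c) (d (*) m (g c)))"
    by (intro sum.cong refl lin_ext_natural)
       (auto simp: module_times C.module_axioms additive_def single_add)
  also have "\<dots> = (\<Sum>c\<in>K. Poly_Mapping.map (single c) (Poly_Mapping.map (\<lambda>v. lookup v c) f))"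
    using g KJ by (intro sum.cong) auto
  also have "\<dots> = f"
  proof (intro poly_mapping_eqI)
    fix b c
    have "finite K" by (simp add: K_def)
    have "lookup (lookup f b) c = 0" if "c \<notin> K"
      using that by (cases "b \<in> keys f") (auto simp: K_def in_keys_iff)
    then show "lookup (lookup (\<Sum>c\<in>K. Poly_Mapping.map (single c) (Poly_Mapping.map (\<lambda>v. lookup v c) f)) b) c
        = lookup (lookup f b) c"
      using \<open>finite K\<close> by (auto simp: lookup_sum lookup_map lookup_single when_def)
  qed
  finally show ?thesis using h by blast
qed

lemma free_tor_vanishes:
  assumes f: "f \<in> tc (shift_sum J \<epsilon> A) (Suc m) j" and df: "d smul m f = 0"
  shows "\<exists>g\<in>tc (shift_sum J \<epsilon> A) (Suc (Suc m)) j. d smul (Suc m) g = f"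
proof (rule boundary_of_coordinates[OF f])
  fix c assume c: "c \<in> J"
  show "\<exists>g\<in>tc A (Suc (Suc m)) (j - \<epsilon> c). d (*) (Suc m) g = Poly_Mapping.map (\<lambda>v. lookup v c) f"
  proof (rule exact_Suc)
    show "Poly_Mapping.map (\<lambda>v. lookup v c) f \<in> tc A (Suc m) (j - \<epsilon> c)"
    proof (intro shift_sumI)
      fix b assume "b \<in> basis F (Suc m)"
      then have "lookup (lookup f b) c \<in> A (j - deg F (Suc m) b - \<epsilon> c)"
        using shift_sumD(2)[OF f] c by (auto dest: shift_sumD(2))
      then show "lookup (Poly_Mapping.map (\<lambda>v. lookup v c) f) b \<in> A (j - \<epsilon> c - deg F (Suc m) b)"
        by (simp add: lookup_map diff_right_commute)
    qed (simp add: lookup_map shift_sumD[OF f])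
    have "d (*) m (Poly_Mapping.map (\<lambda>v. lookup v c) f) = Poly_Mapping.map (\<lambda>v. lookup v c) (d smul m f)"
      by (intro lin_ext_natural) (auto simp: module_times module_pointwise additive_def lookup_add lookup_map)
    then show "d (*) m (Poly_Mapping.map (\<lambda>v. lookup v c) f) = 0"
      by (auto simp: df intro!: poly_mapping_eqI simp: lookup_map)
  qed
qed

text \<open>
  Multiplication by an element of positive degree lifts the zero map of \<open>k\<close>, hence is null homotopic.
  The homotopy is built one homological degree at a time on the bases.
\<close>

lemma homotopy_for_positive_degree:
  assumes p: "p \<in> A l" "0 < l"
  obtains h where
    "\<And>i b. b \<in> basis F i \<Longrightarrow> h i b \<in> tc A (Suc i) (deg F i b + l)"
    "\<And>b. b \<in> basis F 0 \<Longrightarrow> d (*) 0 (h 0 b) = single b p"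
    "\<And>i b. b \<in> basis F (Suc i) \<Longrightarrow>
       d (*) (Suc i) (h (Suc i) b) + lin_ext (*) (h i) (diff F i b) = single b p"
proof -
  interpret A: module "(*) :: 'a \<Rightarrow> 'a \<Rightarrow> 'a" by (rule module_times)
  note gr = graded_submodule_shift_sum[OF graded_submodule_self module_times]
  define hom where "hom i h \<longleftrightarrow> (\<forall>b\<in>basis F i. h b \<in> tc A (Suc i) (deg F i b + l))" for i h
  \<comment> \<open>The property of \<open>h i\<close> that allows the next step: on cycles, \<open>d h\<close> is multiplication by \<open>p\<close>.\<close>
  define cyc where "cyc i h \<longleftrightarrow> (\<forall>j v. v \<in> tc A i j \<longrightarrow> (\<forall>i'. i = Suc i' \<longrightarrow> d (*) i' v = 0) \<longrightarrow>
      d (*) i (lin_ext (*) h v) = smul p v)" for i h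
  define bot where "bot i h \<longleftrightarrow> (i = 0 \<longrightarrow> (\<forall>b\<in>basis F 0. d (*) 0 (h b) = single b p))" for i :: nat and h
  define step where "step i h h' \<longleftrightarrow> (\<forall>b\<in>basis F (Suc i).
      d (*) (Suc i) (h' b) + lin_ext (*) h (diff F i b) = single b p)" for i h h'
  have single_p: "single b p \<in> tc A i (deg F i b + l)" if "b \<in> basis F i" for i b
    using that p(1) by (intro single_in_shift_sum) (auto simp: comp_has_zero)
  have "\<exists>h. \<forall>i. (hom i (h i) \<and> cyc i (h i) \<and> bot i (h i)) \<and> step i (h i) (h (Suc i))"
  proof (rule dependent_nat_choice)
    have "\<exists>w\<in>tc A (Suc 0) (deg F 0 b + l). d (*) 0 w = single b p" if b: "b \<in> basis F 0" for b
    proof -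
      have "aug_map scale A F (single b p) = 0"
        using p by (simp add: aug_map_eq augmentation_nonzero_degree[of p l])
      then have "single b p \<in> d (*) 0 ` tc A (Suc 0) (deg F 0 b + l)"
        using single_p[OF b] unfolding aug_exact[symmetric] by blast
      then show ?thesis by (metis imageE)
    qed
    then obtain h where h: "\<And>b. b \<in> basis F 0 \<Longrightarrow> h b \<in> tc A (Suc 0) (deg F 0 b + l) \<and> d (*) 0 (h b) = single b p"
      by metis
    have "cyc 0 h"
      unfolding cyc_def
    proof (intro allI impI)
      fix j v assume v: "v \<in> tc A 0 j"
      have "d (*) 0 (lin_ext (*) h v) = lin_ext (*) (\<lambda>b. single b p) v"
        unfolding A.lin_ext_lin_ext using h shift_sumD(1)[OF v] by (intro A.lin_ext_cong) auto
      then show "d (*) 0 (lin_ext (*) h v) = smul p v" by (simp add: A.lin_ext_single_map)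
    qed
    with h show "\<exists>h. hom 0 h \<and> cyc 0 h \<and> bot 0 h"
      by (auto simp: hom_def bot_def)
  next
    fix h i assume "hom i h \<and> cyc i h \<and> bot i h"
    then have h: "hom i h" "cyc i h" by auto
    have "\<exists>w\<in>tc A (Suc (Suc i)) (deg F (Suc i) b + l). d (*) (Suc i) w = single b p - lin_ext (*) h (diff F i b)"
      if b: "b \<in> basis F (Suc i)" for b
    proof (rule exact_Suc)
      have "lin_ext (*) h (diff F i b) \<in> tc A (Suc i) (deg F (Suc i) b + l)"
        using h(1) diff_in[OF b] unfolding hom_def
        by (intro lin_ext_in_shift_sum[OF graded_submodule_self module_times, of "basis F i" _ _ _ "deg F i" l]) auto
      then show "single b p - lin_ext (*) h (diff F i b) \<in> tc A (Suc i) (deg F (Suc i) b + l)"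
        using single_p[OF b] by (rule graded_submodule_diff[OF gr, rotated])
      have "d (*) i (single b p) = smul p (diff F i b)"
        by (rule poly_mapping_eqI) (simp add: A.lookup_lin_ext_single lookup_map mult.commute)
      moreover have "d (*) i (lin_ext (*) h (diff F i b)) = smul p (diff F i b)"
        using h(2) diff_in[OF b] d_diff b unfolding cyc_def by metis
      ultimately show "d (*) i (single b p - lin_ext (*) h (diff F i b)) = 0"
        by (simp add: A.lin_ext_diff)
    qed
    then obtain h' where h': "\<And>b. b \<in> basis F (Suc i) \<Longrightarrow> h' b \<in> tc A (Suc (Suc i)) (deg F (Suc i) b + l)
        \<and> d (*) (Suc i) (h' b) = single b p - lin_ext (*) h (diff F i b)"
      by metis
    have "cyc (Suc i) h'"
      unfolding cyc_def
    proof (intro allI impI)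
      fix j v assume v: "v \<in> tc A (Suc i) j" and "\<forall>i'. Suc i = Suc i' \<longrightarrow> d (*) i' v = 0"
      then have dv: "d (*) i v = 0" by simp
      have "d (*) (Suc i) (lin_ext (*) h' v) + lin_ext (*) h (d (*) i v)
          = lin_ext (*) (\<lambda>b. d (*) (Suc i) (h' b) + lin_ext (*) h (diff F i b)) v"
        by (simp add: A.lin_ext_lin_ext A.lin_ext_plus_map)
      also have "\<dots> = lin_ext (*) (\<lambda>b. single b p) v"
        using h' shift_sumD(1)[OF v] by (intro A.lin_ext_cong) auto
      finally show "d (*) (Suc i) (lin_ext (*) h' v) = smul p v"
        by (simp add: dv A.lin_ext_single_map)
    qed
    with h' show "\<exists>h'. (hom (Suc i) h' \<and> cyc (Suc i) h' \<and> bot (Suc i) h') \<and> step i h h'"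
      by (intro exI[of _ h']) (simp add: hom_def bot_def step_def)
  qed
  then show thesis
    using that unfolding hom_def bot_def step_def by metis
qed

end

context tensored_resolution
begin

text \<open>A null homotopy survives base change, so the element acts as zero on \<open>Tor\<close>.\<close>

lemma positive_degree_kills_homology:
  assumes N: "graded_submodule A s N" and p: "p \<in> A l" "0 < l"
    and z: "z \<in> tc N i j" "\<And>i'. i = Suc i' \<Longrightarrow> d s i' z = 0"
  shows "\<exists>w\<in>tc N (Suc i) (j + l). d s i w = Poly_Mapping.map (s p) z"
proof -
  obtain h where h: "\<And>i b. b \<in> basis F i \<Longrightarrow> h i b \<in> tc A (Suc i) (deg F i b + l)"
    "\<And>b. b \<in> basis F 0 \<Longrightarrow> d (*) 0 (h 0 b) = single b p"
    "\<And>i b. b \<in> basis F (Suc i) \<Longrightarrow> d (*) (Suc i) (h (Suc i) b) + lin_ext (*) (h i) (diff F i b) = single b p"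
    using homotopy_for_positive_degree[OF p] by metis
  show ?thesis
  proof
    show "lin_ext s (h i) z \<in> tc N (Suc i) (j + l)"
      using h(1) z(1) by (intro lin_ext_in_shift_sum[OF N N.module_axioms]) auto
    show "d s i (lin_ext s (h i) z) = Poly_Mapping.map (s p) z"
    proof (cases i)
      case 0
      have "d s i (lin_ext s (h i) z) = lin_ext s (\<lambda>b. single b p) z"
        unfolding N.lin_ext_lin_ext using h(2) shift_sumD(1)[OF z(1)] 0 by (intro N.lin_ext_cong) auto
      then show ?thesis by (simp add: N.lin_ext_single_map)
    next
      case (Suc i')
      have "d s i (lin_ext s (h i) z) + lin_ext s (h i') (d s i' z)
          = lin_ext s (\<lambda>b. d (*) i (h i b) + lin_ext (*) (h i') (diff F i' b)) z"
        by (simp add: N.lin_ext_lin_ext N.lin_ext_plus_map)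
      also have "\<dots> = lin_ext s (\<lambda>b. single b p) z"
        using h(3) shift_sumD(1)[OF z(1)] Suc by (intro N.lin_ext_cong) auto
      finally show ?thesis by (simp add: z(2)[OF Suc] N.lin_ext_single_map)
    qed
  qed
qed

end

section \<open>Coefficients in a quotient with trivial action of positive degrees\<close>

context vector_space
begin

text \<open>
  A sequence of vector spaces that is exact over \<open>k\<close> stays exact after tensoring with \<open>Z / B\<close>. Here \<open>P\<close> and \<open>Q\<close>
  are matrices; expanding a vector with entries in \<open>Z\<close> along a basis of \<open>Z\<close> that extends one of \<open>B\<close> gives one
  vector over \<open>k\<close> for every basis element outside \<open>B\<close>.
\<close>

lemma exact_sequence_coefficients:
  fixes P :: "'i \<Rightarrow> 'p \<Rightarrow>\<^sub>0 'a" and Q :: "'q \<Rightarrow> 'i \<Rightarrow>\<^sub>0 'a"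
  assumes exact: "\<And>a. keys a \<subseteq> I \<Longrightarrow> lin_ext (*) P a = 0 \<Longrightarrow> \<exists>e. keys e \<subseteq> J \<and> lin_ext (*) Q e = a"
    and Z: "subspace Z" and B: "subspace B" "B \<subseteq> Z"
    and f: "keys f \<subseteq> I" "\<And>b. lookup f b \<in> Z" and Pf: "\<And>c. lookup (lin_ext scale P f) c \<in> B"
  shows "\<exists>g. keys g \<subseteq> J \<and> (\<forall>c. lookup g c \<in> Z) \<and> (\<forall>b. lookup f b - lookup (lin_ext scale Q g) b \<in> B)"
proof -
  obtain X where X: "X \<subseteq> B" "independent X" "B \<subseteq> span X"
    using maximal_independent_subset[of B] by blast
  obtain Y where Y: "X \<subseteq> Y" "Y \<subseteq> Z" "independent Y" "Z \<subseteq> span Y"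
    using maximal_independent_subset_extend[of X Z] X B by blast
  have spanY: "v \<in> span Y" if "v \<in> Z" for v using that Y(4) by blast
  define rep where "rep v t = representation Y v t" for v t
  have rep0 [simp]: "rep 0 t = 0" for t by (simp add: rep_def representation_zero)
  have repB: "rep v t = 0" if "v \<in> B" "t \<notin> X" for v t
  proof -
    have "representation Y v = representation X v"
      using that X Y by (intro representation_extend) auto
    then show ?thesis using representation_ne_zero[of X v t] that by (auto simp: rep_def)
  qed
  define T where "T = (\<Union>b\<in>keys f. {t. rep (lookup f b) t \<noteq> 0})"
  have finT: "finite T" by (simp add: T_def rep_def finite_representation)
  have TY: "T \<subseteq> Y" using representation_ne_zero[of Y] by (auto simp: T_def rep_def)
  have expand: "lookup f b = (\<Sum>t\<in>T. scale (rep (lookup f b) t) t)" for b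
  proof -
    have "lookup f b = (\<Sum>t | rep (lookup f b) t \<noteq> 0. scale (rep (lookup f b) t) t)"
      using sum_nonzero_representation_eq[OF Y(3) spanY[OF f(2)]] by (simp add: rep_def)
    also have "\<dots> = (\<Sum>t\<in>T. scale (rep (lookup f b) t) t)"
    proof (rule sum.mono_neutral_left[OF finT])
      show "{t. rep (lookup f b) t \<noteq> 0} \<subseteq> T"
        unfolding T_def by (cases "b \<in> keys f") (auto simp: not_in_keys_iff_lookup_eq_zero)
    qed auto
    finally show ?thesis .
  qed
  define a where "a t = Poly_Mapping.map (\<lambda>v. rep v t) f" for t
  have "\<exists>e. keys e \<subseteq> J \<and> lin_ext (*) Q e = a t" if "t \<notin> X" for t
  proof (rule exact)
    have keys_a: "keys (a t) \<subseteq> keys f"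
      by (metis (mono_tags, lifting) a_def lookup_map rep0 in_keys_iff subsetI)
    with f(1) show "keys (a t) \<subseteq> I" by blast
    have "(\<Sum>b\<in>keys f. lookup (P b) c * rep (lookup f b) t) = rep (lookup (lin_ext scale P f) c) t" for c
    proof -
      have "rep (\<Sum>b\<in>K. scale (lookup (P b) c) (lookup f b)) t = (\<Sum>b\<in>K. lookup (P b) c * rep (lookup f b) t)"
        if "finite K" for K
        using that
      proof (induction K)
        case (insert x K)
        have "(\<Sum>b\<in>K. scale (lookup (P b) c) (lookup f b)) \<in> span Y"
          by (intro span_sum span_scale spanY f)
        with insert show ?case
          by (simp add: rep_def representation_add representation_scale Y(3) spanY f span_scale)
      qed simp
      then show ?thesis by (simp add: lookup_lin_ext)
    qed
    then have *: "(\<Sum>b\<in>keys f. lookup (P b) c * rep (lookup f b) t) = 0" for c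
      using repB[OF Pf that] by simp
    show "lin_ext (*) P (a t) = 0"
    proof (rule poly_mapping_eqI)
      fix c
      show "lookup (lin_ext (*) P (a t)) c = lookup 0 c" using keys_a
        by (subst module.lookup_lin_ext_superset[OF module_times, of "keys f"]) (simp_all add: a_def lookup_map *)
    qed
  qed
  then obtain e where e: "\<And>t. t \<notin> X \<Longrightarrow> keys (e t) \<subseteq> J \<and> lin_ext (*) Q (e t) = a t" by metis
  define g where "g = (\<Sum>t\<in>T - X. Poly_Mapping.map (\<lambda>c. scale c t) (e t))"
  have lookup_g: "lookup g c = (\<Sum>t\<in>T - X. scale (lookup (e t) c) t)" for c
    by (simp add: g_def lookup_sum lookup_map)
  have Qg: "lin_ext scale Q g = (\<Sum>t\<in>T - X. Poly_Mapping.map (\<lambda>c. scale c t) (a t))"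
    unfolding g_def lin_ext_sum
  proof (rule sum.cong[OF refl])
    fix t assume t: "t \<in> T - X"
    have "lin_ext scale Q (Poly_Mapping.map (\<lambda>c. scale c t) (e t)) = Poly_Mapping.map (\<lambda>c. scale c t) (lin_ext (*) Q (e t))"
      by (intro lin_ext_natural) (auto simp: module_times module_axioms additive_def scale_left_distrib)
    then show "lin_ext scale Q (Poly_Mapping.map (\<lambda>c. scale c t) (e t)) = Poly_Mapping.map (\<lambda>c. scale c t) (a t)"
      using e t by auto
  qed
  show ?thesis
  proof (intro exI[of _ g] conjI allI)
    have "lookup (e t) c = 0" if "c \<notin> J" "t \<notin> X" for c t
      using e[OF that(2)] that(1) by (meson in_keys_iff subsetD)
    then have "lookup g c = 0" if "c \<notin> J" for c
      using that unfolding lookup_g by (intro sum.neutral) auto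
    then show "keys g \<subseteq> J" by (auto simp: in_keys_iff)
    show "lookup g c \<in> Z" for c
      unfolding lookup_g using TY Y(2) Z by (intro subspace_sum subspace_scale) auto
    fix b
    have "lookup f b - lookup (lin_ext scale Q g) b
        = (\<Sum>t\<in>T. scale (rep (lookup f b) t) t) - (\<Sum>t\<in>T - X. scale (rep (lookup f b) t) t)"
      by (simp add: Qg lookup_sum lookup_map a_def flip: expand)
    also have "\<dots> = (\<Sum>t\<in>T \<inter> X. scale (rep (lookup f b) t) t)"
      using finT by (simp add: sum.Int_Diff[of T _ X])
    also have "\<dots> \<in> B"
      using X(1) B by (intro subspace_sum subspace_scale) auto
    finally show "lookup f b - lookup (lin_ext scale Q g) b \<in> B" .
  qed
qed

end

context connected_algebra
begin

lemma vector_space_restrict_scalars: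
  assumes "module s" shows "vector_space (\<lambda>c. s (scale c 1))"
proof -
  interpret N: module s by fact
  show ?thesis
    by standard (simp_all add: N.scale_right_distrib N.scale_left_distrib scale_left_distrib scalar_mult
        del: scale_scale)
qed

end

context tensored_resolution
begin

abbreviation "scalar c \<equiv> s (scale c 1)"

text \<open>The differential of \<open>F \<otimes> k\<close>.\<close>

abbreviation "reduced i b \<equiv> Poly_Mapping.map (augmentation scale A) (diff F i b)"

context
  fixes N B
  assumes N: "graded_submodule A s N" and B: "graded_submodule A s B" and BN: "\<And>l. B l \<subseteq> N l"
    and triv: "\<And>i l a v. a \<in> A i \<Longrightarrow> 0 < i \<Longrightarrow> v \<in> N l \<Longrightarrow> s a v \<in> B (i + l)"
begin

text \<open>
  Entries of the differential of positive degree map \<open>N\<close> into \<open>B\<close>, and those of negative degree are zero. So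
  modulo \<open>B\<close> only the scalar entries remain, which connect basis elements of equal degree.
\<close>

lemma differential_mod_trivial:
  assumes f: "f \<in> tc N (Suc i) j" and c: "c \<in> basis F i"
  shows "lookup (d s i f) c
      - (\<Sum>b | b \<in> keys f \<and> deg F (Suc i) b = deg F i c. scalar (lookup (reduced i b) c) (lookup f b))
    \<in> B (j - deg F i c)" (is "_ - ?S \<in> _")
proof -
  let ?e = "deg F (Suc i)" and ?l = "deg F i c"
  have "?S = (\<Sum>b\<in>keys f. if ?e b = ?l then scalar (lookup (reduced i b) c) (lookup f b) else 0)"
    by (simp add: sum.If_cases Int_def)
  then have "lookup (d s i f) c - ?S = (\<Sum>b\<in>keys f. s (lookup (diff F i b) c) (lookup f b)
      - (if ?e b = ?l then scalar (lookup (reduced i b) c) (lookup f b) else 0))"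
    by (simp add: lookup_lin_ext sum_subtractf)
  also have "\<dots> \<in> B (j - ?l)"
  proof (rule graded_submodule_sum[OF B])
    fix b assume "b \<in> keys f"
    then have b: "b \<in> basis F (Suc i)" "lookup f b \<in> N (j - ?e b)"
      using shift_sumD[OF f] by auto
    have r: "lookup (diff F i b) c \<in> A (?e b - ?l)"
      using shift_sumD(2)[OF diff_in[OF b(1)] c] .
    show "s (lookup (diff F i b) c) (lookup f b)
      - (if ?e b = ?l then scalar (lookup (reduced i b) c) (lookup f b) else 0) \<in> B (j - ?l)"
    proof (cases "?e b" ?l rule: linorder_cases)
      case less
      then have "lookup (diff F i b) c = 0" using r comp_negative by auto
      then show ?thesis using less by (simp add: graded_submodule_zero[OF B])
    next
      case equal
      then have "lookup (diff F i b) c = scale (lookup (reduced i b) c) 1"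
        using r comp_zero_eq_augmentation by (simp add: lookup_map)
      then show ?thesis using equal by (simp add: graded_submodule_zero[OF B])
    next
      case greater
      then show ?thesis using triv[OF r _ b(2)] by simp
    qed
  qed
  finally show ?thesis .
qed

text \<open>
  As \<open>A\<^sub>+\<close> acts trivially, \<open>F \<otimes> N / B\<close> is the tensor product over \<open>k\<close> of \<open>F \<otimes> k\<close> and \<open>N / B\<close>. Its degree \<open>j\<close>
  component is the sum over \<open>l\<close> of \<open>(F \<otimes> k)\<^sub>l \<otimes> (N / B)\<^sub>j\<^sub>-\<^sub>l\<close>. If \<open>l\<close> exceeds the homological degree, the first
  factor is exact, and otherwise \<open>j - l\<close> exceeds \<open>h\<close> and the second factor is zero. The proof
  treats the summands separately, where \<open>l\<close> is the degree of the basis elements of \<open>F\<close>.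
\<close>

lemma quotient_tor_vanishes:
  assumes top: "\<And>l. h < l \<Longrightarrow> N l \<subseteq> B l"
    and residue: "\<And>l. int (Suc m) < l \<Longrightarrow>
      cycles F (residue_field scale A) (Suc m) l \<subseteq> boundaries F (residue_field scale A) (Suc m) l"
    and j: "h + int (Suc m) < j"
    and f: "f \<in> tc N (Suc m) j" "d s m f \<in> tc B m j"
  shows "\<exists>g\<in>tc N (Suc (Suc m)) j. f - d s (Suc m) g \<in> tc B (Suc m) j"
proof -
  interpret V: vector_space scalar
    using N.module_axioms by (rule vector_space_restrict_scalars)
  define L where "L = deg F (Suc m) ` keys f"
  have B_sub: "V.subspace (B l)" and N_sub: "V.subspace (N l)" for l
    by (auto intro!: V.subspaceI simp: graded_submodule_zero[OF B] graded_submodule_zero[OF N]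
        graded_submodule_add[OF B] graded_submodule_add[OF N]
        intro: graded_submodule_act[OF B scalar_in_comp_zero] graded_submodule_act[OF N scalar_in_comp_zero])
  have exact: "\<exists>e. keys e \<subseteq> {c \<in> basis F (Suc (Suc m)). deg F (Suc (Suc m)) c = l} \<and>
        lin_ext (*) (reduced (Suc m)) e = a"
    if l: "int (Suc m) < l" and a: "keys a \<subseteq> {b \<in> basis F (Suc m). deg F (Suc m) b = l}"
      "lin_ext (*) (reduced m) a = 0" for a l
  proof -
    let ?k = "residue_field scale A"
    have diff_k: "tensor_diff F ?k i a' = lin_ext (*) (reduced i) a'" for i a'
      unfolding tensor_diff_eq_lin_ext
      by (rule poly_mapping_eqI) (simp add: lookup_lin_ext lookup_map residue_field_def)
    have "a \<in> tensor_comp F ?k (Suc m) l"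
      using a(1) by (auto simp: tensor_comp_def residue_field_def in_keys_iff)
    then have "a \<in> cycles F ?k (Suc m) l"
      using a(2) by (simp add: cycles_def diff_k)
    then obtain e where e: "e \<in> tensor_comp F ?k (Suc (Suc m)) l" "lin_ext (*) (reduced (Suc m)) e = a"
      using residue[OF l] by (auto simp: boundaries_def diff_k)
    have "keys e \<subseteq> {c \<in> basis F (Suc (Suc m)). deg F (Suc (Suc m)) c = l}"
      using e(1) by (force simp: tensor_comp_def residue_field_def in_keys_iff split: if_splits)
    then show ?thesis using e(2) by blast
  qed
  have "\<forall>l. \<exists>g. keys g \<subseteq> {c \<in> basis F (Suc (Suc m)). deg F (Suc (Suc m)) c = l} \<and>
       (\<forall>c. lookup g c \<in> N (j - l)) \<and>
       (\<forall>b\<in>basis F (Suc m). deg F (Suc m) b = l \<longrightarrow>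
           lookup f b - lookup (lin_ext scalar (reduced (Suc m)) g) b \<in> B (j - l))"
    (is "\<forall>l. \<exists>g. ?good l g")
  proof
    fix l
    show "\<exists>g. ?good l g"
    proof (cases "int (Suc m) < l")
      case False
      then have "N (j - l) \<subseteq> B (j - l)" using j by (intro top) auto
      then have "lookup f b \<in> B (j - l)" if "b \<in> basis F (Suc m)" "deg F (Suc m) b = l" for b
        using shift_sumD(2)[OF f(1) that(1)] that(2) by blast
      then show ?thesis
        by (intro exI[of _ 0]) (auto simp: graded_submodule_zero[OF N])
    next
      case True
      define K where "K = {b \<in> keys f. deg F (Suc m) b = l}"
      define fl where "fl = (\<Sum>b\<in>K. single b (lookup f b))"
      have fl: "lookup fl b = (if b \<in> K then lookup f b else 0)" for b
        by (simp add: fl_def K_def lookup_sum_single)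
      have keys_fl: "keys fl = K"
        by (auto simp: in_keys_iff fl K_def split: if_splits)
      have Kb: "b \<in> basis F (Suc m)" if "b \<in> K" for b
        using that shift_sumD(1)[OF f(1)] by (auto simp: K_def)
      obtain g where g: "keys g \<subseteq> {c \<in> basis F (Suc (Suc m)). deg F (Suc (Suc m)) c = l}"
        "\<And>c. lookup g c \<in> N (j - l)"
        "\<And>b. lookup fl b - lookup (lin_ext scalar (reduced (Suc m)) g) b \<in> B (j - l)"
      proof -
        have "\<exists>g. keys g \<subseteq> {c \<in> basis F (Suc (Suc m)). deg F (Suc (Suc m)) c = l} \<and>
           (\<forall>c. lookup g c \<in> N (j - l)) \<and>
           (\<forall>b. lookup fl b - lookup (lin_ext scalar (reduced (Suc m)) g) b \<in> B (j - l))"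
        proof (rule V.exact_sequence_coefficients[OF exact[OF True] N_sub B_sub BN])
          show "keys fl \<subseteq> {b \<in> basis F (Suc m). deg F (Suc m) b = l}"
            using Kb by (auto simp: keys_fl K_def)
          show "lookup fl b \<in> N (j - l)" for b
            using shift_sumD(2)[OF f(1) Kb, of b] by (auto simp: fl K_def graded_submodule_zero[OF N])
          show "lookup (lin_ext scalar (reduced m) fl) c \<in> B (j - l)" for c
          proof (cases "c \<in> basis F m \<and> deg F m c = l")
            case True
            have "lookup (lin_ext scalar (reduced m) fl) c
                = (\<Sum>b | b \<in> keys f \<and> deg F (Suc m) b = deg F m c. scalar (lookup (reduced m b) c) (lookup f b))"
              using True by (simp add: lookup_lin_ext keys_fl K_def fl)
            moreover have "lookup (d s m f) c \<in> B (j - l)"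
              using shift_sumD(2)[OF f(2), of c] True by simp
            ultimately show ?thesis
              using graded_submodule_diff[OF B _ differential_mod_trivial[OF f(1), of c]] True by fastforce
          next
            case False
            have "lookup (reduced m b) c = 0" if "b \<in> K" for b
            proof (cases "c \<in> basis F m")
              case True
              have "lookup (diff F m b) c \<in> A (l - deg F m c)"
                using shift_sumD(2)[OF diff_in[OF Kb[OF that]] True] that by (simp add: K_def)
              then show ?thesis
                using False True augmentation_nonzero_degree by (simp add: lookup_map)
            next
              case False
              then show ?thesis
                using shift_sumD(3)[OF diff_in[OF Kb[OF that]]] by (simp add: lookup_map)
            qed
            then have "lookup (lin_ext scalar (reduced m) fl) c = 0"
              by (simp add: lookup_lin_ext keys_fl)
            then show ?thesis by (simp add: graded_submodule_zero[OF B])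
          qed
        qed
        then show thesis using that by blast
      qed
      have "lookup f b - lookup (lin_ext scalar (reduced (Suc m)) g) b \<in> B (j - l)"
        if "b \<in> basis F (Suc m)" "deg F (Suc m) b = l" for b
      proof -
        have "lookup fl b = lookup f b" using that by (auto simp: fl K_def in_keys_iff)
        then show ?thesis using g(3)[of b] by simp
      qed
      with g show ?thesis by blast
    qed
  qed
  from choice[OF this] obtain g where good: "\<forall>l. ?good l (g l)" ..
  have g: "\<And>l. keys (g l) \<subseteq> {c \<in> basis F (Suc (Suc m)). deg F (Suc (Suc m)) c = l}"
     "\<And>l c. lookup (g l) c \<in> N (j - l)"
     "b \<in> basis F (Suc m) \<Longrightarrow>
        lookup f b - lookup (lin_ext scalar (reduced (Suc m)) (g (deg F (Suc m) b))) b \<in> B (j - deg F (Suc m) b)" for b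
    using good by simp_all
  define G where "G = (\<Sum>l\<in>L. g l)"
  have finL: "finite L" by (simp add: L_def)
  have g_other: "lookup (g l) c = 0" if "deg F (Suc (Suc m)) c \<noteq> l" for l c
    using g(1)[of l] that by (auto simp: in_keys_iff)
  have G: "lookup G c = (if deg F (Suc (Suc m)) c \<in> L then lookup (g (deg F (Suc (Suc m)) c)) c else 0)" for c
  proof -
    have "lookup G c = (\<Sum>l\<in>L. if l = deg F (Suc (Suc m)) c then lookup (g l) c else 0)"
      unfolding G_def lookup_sum using g_other by (intro sum.cong) auto
    then show ?thesis using finL by (simp add: sum.delta')
  qed
  have G_in: "G \<in> tc N (Suc (Suc m)) j"
  proof (rule shift_sumI)
    fix c assume "c \<notin> basis F (Suc (Suc m))"
    then have "lookup (g l) c = 0" for l using g(1)[of l] by (auto simp: in_keys_iff)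
    then show "lookup G c = 0" by (simp add: G)
  qed (simp add: G g(2) graded_submodule_zero[OF N])
  show ?thesis
  proof (rule bexI[OF _ G_in], rule shift_sumI)
    fix b assume b: "b \<in> basis F (Suc m)"
    let ?l = "deg F (Suc m) b"
    let ?S = "(\<Sum>c | c \<in> keys G \<and> deg F (Suc (Suc m)) c = ?l. scalar (lookup (reduced (Suc m) c) b) (lookup G c))"
    have "lookup f b - ?S \<in> B (j - ?l)"
    proof (cases "?l \<in> L")
      case True
      have "{c \<in> keys G. deg F (Suc (Suc m)) c = ?l} = keys (g ?l)"
      proof -
        have "c \<in> keys G \<and> deg F (Suc (Suc m)) c = ?l \<longleftrightarrow> lookup (g ?l) c \<noteq> 0" for c
          using True g_other[of c ?l] by (cases "deg F (Suc (Suc m)) c = ?l") (simp_all add: in_keys_iff G)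
        then show ?thesis by (simp add: set_eq_iff in_keys_iff[of _ "g ?l"])
      qed
      moreover have "lookup G c = lookup (g ?l) c" if "c \<in> keys (g ?l)" for c
        using that True g(1)[of ?l] by (auto simp: G)
      ultimately have "?S = lookup (lin_ext scalar (reduced (Suc m)) (g ?l)) b"
        by (simp add: lookup_lin_ext)
      then show ?thesis using g(3)[OF b] by simp
    next
      case False
      then have "{c \<in> keys G. deg F (Suc (Suc m)) c = ?l} = {}" by (auto simp: in_keys_iff G)
      then have "?S = 0" by (metis sum.empty)
      moreover have "lookup f b = 0" using False by (auto simp: L_def in_keys_iff)
      ultimately show ?thesis by (simp add: graded_submodule_zero[OF B])
    qed
    from graded_submodule_diff[OF B this differential_mod_trivial[OF G_in b]]
    show "lookup (f - d s (Suc m) G) b \<in> B (j - ?l)" by (simp add: lookup_minus)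
  next
    fix b assume "b \<notin> basis F (Suc m)"
    then show "lookup (f - d s (Suc m) G) b = 0"
      using shift_sumD(3)[OF f(1)] shift_sumD(3)[OF d_in[OF N G_in]] by (simp add: lookup_minus)
  qed
qed

end

end

section \<open>Existence of free resolutions\<close>

lemma lin_ext_times_eq_sum:
  fixes \<phi> :: "'b \<Rightarrow> 'c \<Rightarrow>\<^sub>0 'a::comm_ring_1"
  shows "lin_ext (*) \<phi> f = (\<Sum>b\<in>keys f. Poly_Mapping.map ((*) (lookup f b)) (\<phi> b))"
  by (rule poly_mapping_eqI) (simp add: lookup_lin_ext lookup_sum lookup_map mult.commute)

lemma lin_ext_times_scale:
  fixes \<phi> :: "'b \<Rightarrow> 'c \<Rightarrow>\<^sub>0 'a::comm_ring_1"
  shows "lin_ext (*) \<phi> (Poly_Mapping.map ((*) a) f) = Poly_Mapping.map ((*) a) (lin_ext (*) \<phi> f)"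
  by (intro lin_ext_natural) (auto simp: module_times additive_def algebra_simps)

context connected_algebra
begin

text \<open>
  A free module whose basis is bounded below and finite in each degree has components of finite rank.
  This is what keeps the bases countable.
\<close>

definition locally_finite_graded_set :: "nat set \<Rightarrow> (nat \<Rightarrow> int) \<Rightarrow> bool" where
  "locally_finite_graded_set I \<delta> \<longleftrightarrow> (\<forall>b\<in>I. 0 \<le> \<delta> b) \<and> (\<forall>j. finite {b \<in> I. \<delta> b \<le> j})"

definition free_submodule :: "nat set \<Rightarrow> (nat \<Rightarrow> int) \<Rightarrow> (int \<Rightarrow> (nat \<Rightarrow>\<^sub>0 'a) set) \<Rightarrow> bool" where
  "free_submodule I \<delta> Z \<longleftrightarrow> graded_submodule A (\<lambda>a. Poly_Mapping.map ((*) a)) Z \<and>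
      (\<forall>j. Z j \<subseteq> shift_sum I \<delta> A j)"

lemma vector_space_pointwise: "vector_space (\<lambda>c. Poly_Mapping.map ((*) (scale c 1)) :: ('b \<Rightarrow>\<^sub>0 'a) \<Rightarrow> _)"
proof -
  interpret N: module "\<lambda>a. Poly_Mapping.map ((*) a) :: ('b \<Rightarrow>\<^sub>0 'a) \<Rightarrow> _"
    by (intro module_pointwise module_times)
  show ?thesis
    by standard (simp_all add: N.scale_right_distrib N.scale_left_distrib scale_left_distrib scalar_mult
        del: scale_scale)
qed

text \<open>
  Generators are chosen over \<open>k\<close> rather than over the algebra, which gives a resolution that is far from
  minimal but avoids any choice of minimal generators.
\<close>

lemma finite_generators:
  assumes I: "locally_finite_graded_set I \<delta>" and Z: "free_submodule I \<delta> Z"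
  shows "\<exists>T. finite T \<and> T \<subseteq> Z j \<and> (j < 0 \<longrightarrow> T = {}) \<and>
     (\<forall>z\<in>Z j. \<exists>a. z = (\<Sum>t\<in>T. Poly_Mapping.map ((*) (scale (a t) 1)) t))"
proof -
  interpret V: vector_space "\<lambda>c. Poly_Mapping.map ((*) (scale c 1)) :: (nat \<Rightarrow>\<^sub>0 'a) \<Rightarrow> _"
    by (rule vector_space_pointwise)
  have ZI: "Z j \<subseteq> shift_sum I \<delta> A j"
    using Z by (simp add: free_submodule_def)
  define K where "K = {b \<in> I. \<delta> b \<le> j}"
  have K: "finite K" using I by (simp add: K_def locally_finite_graded_set_def)
  have keysK: "keys f \<subseteq> K" if "f \<in> shift_sum I \<delta> A j" for f
    using shift_sumD[OF that] comp_negative[of "j - \<delta> _"] by (fastforce simp: K_def in_keys_iff)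
  obtain X where X: "\<And>i. finite (X i)" "\<And>i. A i \<subseteq> span (X i)"
    using comp_finite_rank by metis
  define W where "W = (\<Union>b\<in>K. single b ` X (j - \<delta> b))"
  have "f \<in> V.span W" if f: "f \<in> shift_sum I \<delta> A j" for f
  proof -
    have "single b a \<in> V.span W" if "b \<in> K" "a \<in> span (X (j - \<delta> b))" for a b
      using that(2)
    proof (induction rule: span_induct_alt)
      case (step c x y)
      have "single b x \<in> V.span W"
        using step(1) that(1) by (intro V.span_base) (auto simp: W_def)
      then have "Poly_Mapping.map ((*) (scale c 1)) (single b x) + single b y \<in> V.span W"
        using step by (intro V.span_add V.span_scale)
      moreover have "single b (scale c x + y) = Poly_Mapping.map ((*) (scale c 1)) (single b x) + single b y"
        by (simp add: single_add scale_eq_times)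
      ultimately show ?case by (simp only:)
    qed (simp add: V.span_zero)
    then have "single b (lookup f b) \<in> V.span W" if "b \<in> K" for b
      using shift_sumD(2)[OF f, of b] X(2) that by (auto simp: K_def)
    then have "(\<Sum>b\<in>K. single b (lookup f b)) \<in> V.span W" by (intro V.span_sum)
    moreover have "(\<Sum>b\<in>K. single b (lookup f b)) = f"
      using keysK[OF f] by (intro poly_mapping_eqI) (auto simp: lookup_sum_single[OF K] in_keys_iff)
    ultimately show ?thesis by simp
  qed
  then have ZW: "Z j \<subseteq> V.span W" using ZI by auto
  obtain T where T: "T \<subseteq> Z j" "V.independent T" "Z j \<subseteq> V.span T"
    using V.maximal_independent_subset by blast
  have "finite W" using K X(1) by (simp add: W_def)
  then have finT: "finite T" using V.independent_span_bound[of W T] T ZW by blast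
  have gen: "\<exists>a. z = (\<Sum>t\<in>T. Poly_Mapping.map ((*) (scale (a t) 1)) t)" if "z \<in> Z j" for z
    using T(3) that V.span_finite[OF finT] by blast
  have "T = {}" if "j < 0"
  proof -
    have "f = 0" if "f \<in> Z j" for f
    proof -
      have "K = {}" using I \<open>j < 0\<close> by (force simp: K_def locally_finite_graded_set_def)
      then show ?thesis using keysK[of f] ZI that by auto
    qed
    then have "T \<subseteq> {0}" using T(1) by auto
    then show ?thesis using V.dependent_zero T(2) by blast
  qed
  with gen finT T(1) show ?thesis by blast
qed

definition covers :: "nat set \<Rightarrow> (nat \<Rightarrow> int) \<Rightarrow> (nat \<Rightarrow> nat \<Rightarrow>\<^sub>0 'a) \<Rightarrow> (int \<Rightarrow> (nat \<Rightarrow>\<^sub>0 'a) set) \<Rightarrow> bool" where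
  "covers I \<delta> \<phi> Z \<longleftrightarrow> (\<forall>b\<in>I. \<phi> b \<in> Z (\<delta> b)) \<and> (\<forall>j. lin_ext (*) \<phi> ` shift_sum I \<delta> A j = Z j)"

text \<open>
  The basis consists of the pairs of a degree \<open>j\<close> and one of the finitely many generators in degree \<open>j\<close>. There are
  countably many pairs, which are numbered to obtain a set of naturals.
\<close>

lemma free_cover_exists:
  assumes I: "locally_finite_graded_set I \<delta>" and Z: "free_submodule I \<delta> Z"
  shows "\<exists>I' \<delta>' \<phi>. locally_finite_graded_set I' \<delta>' \<and> covers I' \<delta>' \<phi> Z"
proof -
  have Zgr: "graded_submodule A (\<lambda>a. Poly_Mapping.map ((*) a)) Z"
    using Z by (auto simp: free_submodule_def)
  have "\<forall>j. \<exists>T. finite T \<and> T \<subseteq> Z j \<and> (j < 0 \<longrightarrow> T = {}) \<and>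
     (\<forall>z\<in>Z j. \<exists>a. z = (\<Sum>t\<in>T. Poly_Mapping.map ((*) (scale (a t) 1)) t))"
    (is "\<forall>j. \<exists>T. ?P j T")
    by (rule allI, rule finite_generators[OF I Z])
  from choice[OF this] obtain T where gen: "\<forall>j. ?P j (T j)" ..
  have T: "finite (T j)" "T j \<subseteq> Z j" "j < 0 \<Longrightarrow> T j = {}"
    "z \<in> Z j \<Longrightarrow> \<exists>a. z = (\<Sum>t\<in>T j. Poly_Mapping.map ((*) (scale (a t) 1)) t)" for j z
    using gen by simp_all
  define E where "E = (SIGMA j:UNIV. T j)"
  have "countable E"
    unfolding E_def using T(1) by (intro countable_SIGMA) (auto intro: countable_finite)
  define I' where "I' = to_nat_on E ` E"
  define \<delta>' where "\<delta>' b = fst (from_nat_into E b)" for b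
  define \<phi> where "\<phi> b = snd (from_nat_into E b)" for b
  have dec: "\<delta>' (to_nat_on E (j, t)) = j" "\<phi> (to_nat_on E (j, t)) = t" if "t \<in> T j" for j t
    using \<open>countable E\<close> that by (simp_all add: \<delta>'_def \<phi>_def E_def)
  have "locally_finite_graded_set I' \<delta>'"
    unfolding locally_finite_graded_set_def
  proof (intro conjI ballI allI)
    fix b assume "b \<in> I'"
    then obtain j t where b: "b = to_nat_on E (j, t)" "t \<in> T j" by (auto simp: I'_def E_def)
    then have "\<not> j < 0" using T(3) by auto
    then show "0 \<le> \<delta>' b" using b dec by simp
  next
    fix l
    have "{b \<in> I'. \<delta>' b \<le> l} \<subseteq> to_nat_on E ` (SIGMA j:{0..l}. T j)"
    proof
      fix b assume "b \<in> {b \<in> I'. \<delta>' b \<le> l}"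
      then obtain j t where b: "b = to_nat_on E (j, t)" "t \<in> T j" "\<delta>' b \<le> l" by (auto simp: I'_def E_def)
      moreover have "\<not> j < 0" using T(3) b by auto
      ultimately show "b \<in> to_nat_on E ` (SIGMA j:{0..l}. T j)" using dec by auto
    qed
    then show "finite {b \<in> I'. \<delta>' b \<le> l}"
      by (rule finite_subset) (simp add: T(1))
  qed
  moreover have "covers I' \<delta>' \<phi> Z"
    unfolding covers_def
  proof (intro conjI ballI allI)
    fix b assume "b \<in> I'"
    then obtain j t where "b = to_nat_on E (j, t)" "t \<in> T j" by (auto simp: I'_def E_def)
    then show "\<phi> b \<in> Z (\<delta>' b)" using dec subsetD[OF T(2)] by auto
  next
    fix j
    show "lin_ext (*) \<phi> ` shift_sum I' \<delta>' A j = Z j"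
    proof (intro equalityI subsetI)
      fix z assume "z \<in> lin_ext (*) \<phi> ` shift_sum I' \<delta>' A j"
      then obtain f where f: "f \<in> shift_sum I' \<delta>' A j" "z = lin_ext (*) \<phi> f" by auto
      have "Poly_Mapping.map ((*) (lookup f b)) (\<phi> b) \<in> Z j" if b: "b \<in> keys f" for b
      proof -
        have "b \<in> I'" "lookup f b \<in> A (j - \<delta>' b)" using shift_sumD[OF f(1)] b by auto
        then show ?thesis
          using dec subsetD[OF T(2)] by (intro graded_submodule_act[OF Zgr, where j="\<delta>' b"]) (auto simp: I'_def E_def)
      qed
      then show "z \<in> Z j" unfolding f(2) lin_ext_times_eq_sum by (intro graded_submodule_sum[OF Zgr])
    next
      fix z assume "z \<in> Z j"
      then obtain a where z: "z = (\<Sum>t\<in>T j. Poly_Mapping.map ((*) (scale (a t) 1)) t)" using T(4) by blast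
      interpret reg: module "(*) :: 'a \<Rightarrow> 'a \<Rightarrow> 'a" by (rule module_times)
      define f where "f = (\<Sum>t\<in>T j. single (to_nat_on E (j, t)) (scale (a t) 1))"
      have "f \<in> shift_sum I' \<delta>' A j"
        unfolding f_def
      proof (rule graded_submodule_sum[OF graded_submodule_shift_sum[OF graded_submodule_self module_times]])
        fix t assume "t \<in> T j"
        then show "single (to_nat_on E (j, t)) (scale (a t) 1) \<in> shift_sum I' \<delta>' A j"
          using dec by (intro single_in_shift_sum[where l=0])
             (auto simp: I'_def E_def scalar_in_comp_zero comp_has_zero)
      qed
      moreover have "lin_ext (*) \<phi> f = z"
        unfolding f_def z reg.lin_ext_sum
      proof (rule sum.cong[OF refl])
        fix t assume "t \<in> T j"
        then show "lin_ext (*) \<phi> (single (to_nat_on E (j, t)) (scale (a t) 1))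
            = Poly_Mapping.map ((*) (scale (a t) 1)) t"
          using dec by (intro poly_mapping_eqI) (simp add: reg.lookup_lin_ext_single lookup_map mult.commute)
      qed
      ultimately show "z \<in> lin_ext (*) \<phi> ` shift_sum I' \<delta>' A j" by blast
    qed
  qed
  ultimately show ?thesis by blast
qed

lemma kernel_free_submodule:
  "free_submodule I \<delta> (\<lambda>j. {f \<in> shift_sum I \<delta> A j. lin_ext (*) \<phi> f = 0})"
proof -
  note gr = graded_submodule_shift_sum[OF graded_submodule_self module_times]
  interpret reg: module "(*) :: 'a \<Rightarrow> 'a \<Rightarrow> 'a" by (rule module_times)
  show ?thesis
    unfolding free_submodule_def
    by (intro conjI graded_submoduleI)
       (auto simp: graded_submodule_zero[OF gr] graded_submodule_diff[OF gr] reg.lin_ext_diff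
          lin_ext_times_scale map_eq_zero_iff intro: graded_submodule_act[OF gr])
qed

lemma augmentation_kernel_free_submodule:
  "free_submodule {0} (\<lambda>_. 0) (\<lambda>j. {f \<in> shift_sum {0} (\<lambda>_. 0) A j. augmentation scale A (lookup f 0) = 0})"
proof -
  note gr = graded_submodule_shift_sum[OF graded_submodule_self module_times]
  have diff: "augmentation scale A (u - v) = 0"
    if "u \<in> A j" "v \<in> A j" "augmentation scale A u = 0" "augmentation scale A v = 0" for u v j
  proof (cases "j = 0")
    case True
    then have "u = 0" "v = 0" using that comp_zero_eq_augmentation[of u] comp_zero_eq_augmentation[of v] by auto
    then show ?thesis by simp
  next
    case False
    then show ?thesis
      using that by (intro augmentation_nonzero_degree) (auto intro: subspace_diff comp_subspace)
  qed
  have act: "augmentation scale A (a * v) = 0"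
    if "a \<in> A i" "v \<in> A j" "augmentation scale A v = 0" for a v i j
  proof (cases "i + j = 0")
    case True
    have "a = 0 \<or> v = 0"
      using that comp_negative[of i] comp_negative[of j] comp_zero_eq_augmentation[of v] True
      by (cases i "0::int" rule: linorder_cases) auto
    then show ?thesis by auto
  next
    case False
    then show ?thesis using that comp_times by (intro augmentation_nonzero_degree)
  qed
  show ?thesis
    unfolding free_submodule_def
    by (intro conjI graded_submoduleI)
       (auto simp: graded_submodule_zero[OF gr] graded_submodule_diff[OF gr] lookup_minus lookup_map
          intro: graded_submodule_act[OF gr] diff act dest: shift_sumD(2))
qed

text \<open>
  Start with \<open>A\<close> itself, with one basis element in degree \<open>0\<close>, and cover the kernel of each map by the next free module.
\<close>

theorem free_resolution_exists: "\<exists>F. is_free_resolution scale A F"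
proof -
  \<comment> \<open>A stage consists of a basis with degrees, the map to the previous stage, and the kernel \<open>Z\<close> that the
      next stage has to cover.\<close>
  define good where "good i x \<longleftrightarrow> (case x of (I, \<delta>, \<phi>, Z) \<Rightarrow>
     locally_finite_graded_set I \<delta> \<and> free_submodule I \<delta> Z \<and>
     (i = 0 \<longrightarrow> I = {0} \<and> \<delta> = (\<lambda>_. 0) \<and>
        Z = (\<lambda>j. {f \<in> shift_sum {0} (\<lambda>_. 0) A j. augmentation scale A (lookup f 0) = 0})))"
    for i :: nat and x :: "nat set \<times> (nat \<Rightarrow> int) \<times> (nat \<Rightarrow> nat \<Rightarrow>\<^sub>0 'a) \<times> (int \<Rightarrow> (nat \<Rightarrow>\<^sub>0 'a) set)"
  define next_to where "next_to x x' \<longleftrightarrow> (case x of (I, \<delta>, \<phi>, Z) \<Rightarrow> case x' of (I', \<delta>', \<phi>', Z') \<Rightarrow>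
     covers I' \<delta>' \<phi>' Z \<and> Z' = (\<lambda>j. {f \<in> shift_sum I' \<delta>' A j. lin_ext (*) \<phi>' f = 0}))"
    for x x' :: "nat set \<times> (nat \<Rightarrow> int) \<times> (nat \<Rightarrow> nat \<Rightarrow>\<^sub>0 'a) \<times> (int \<Rightarrow> (nat \<Rightarrow>\<^sub>0 'a) set)"
  have "\<exists>x. \<forall>i. good i (x i) \<and> next_to (x i) (x (Suc i))"
  proof (rule dependent_nat_choice)
    have "locally_finite_graded_set {0} (\<lambda>_. 0)" by (simp add: locally_finite_graded_set_def)
    then show "\<exists>x. good 0 x"
      using augmentation_kernel_free_submodule by (auto simp: good_def)
  next
    fix x i assume "good i x"
    moreover obtain I \<delta> \<phi> Z where x: "x = (I, \<delta>, \<phi>, Z)" by (cases x)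
    ultimately have "locally_finite_graded_set I \<delta>" "free_submodule I \<delta> Z"
      by (simp_all add: good_def)
    from free_cover_exists[OF this] obtain I' \<delta>' \<phi>'
      where "locally_finite_graded_set I' \<delta>'" "covers I' \<delta>' \<phi>' Z" by blast
    then show "\<exists>x'. good (Suc i) x' \<and> next_to x x'"
      using kernel_free_submodule[of I' \<delta>' \<phi>'] by (auto simp: good_def next_to_def x)
  qed
  then obtain x where x: "\<And>i. good i (x i)" "\<And>i. next_to (x i) (x (Suc i))" by blast
  define I where "I i = fst (x i)" for i
  define \<delta> where "\<delta> i = fst (snd (x i))" for i
  define \<phi> where "\<phi> i = fst (snd (snd (x i)))" for i
  define Z where "Z i = snd (snd (snd (x i)))" for i
  have xi: "x i = (I i, \<delta> i, \<phi> i, Z i)" for i by (simp add: I_def \<delta>_def \<phi>_def Z_def)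
  have start: "I 0 = {0}" "\<delta> 0 = (\<lambda>_. 0)"
      "Z 0 = (\<lambda>j. {f \<in> shift_sum {0} (\<lambda>_. 0) A j. augmentation scale A (lookup f 0) = 0})"
    using x(1)[of 0] by (auto simp: good_def xi)
  have Zsub: "Z i j \<subseteq> shift_sum (I i) (\<delta> i) A j" for i j
    using x(1)[of i] by (auto simp: good_def xi free_submodule_def)
  have step: "covers (I (Suc i)) (\<delta> (Suc i)) (\<phi> (Suc i)) (Z i)"
      "Z (Suc i) = (\<lambda>j. {f \<in> shift_sum (I (Suc i)) (\<delta> (Suc i)) A j. lin_ext (*) (\<phi> (Suc i)) f = 0})" for i
    using x(2)[of i] by (auto simp: next_to_def xi)
  define F :: "('a, 'k) free_complex" where "F = \<lparr>basis = I, deg = \<delta>, diff = (\<lambda>i. \<phi> (Suc i)), aug = (\<lambda>_. 1)\<rparr>"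
  have F: "basis F = I" "deg F = \<delta>" "diff F = (\<lambda>i. \<phi> (Suc i))" "aug F = (\<lambda>_. 1)"
    by (simp_all add: F_def)
  have reg: "comp (regular_module A) = A" "act (regular_module A) = (*)"
    by (simp_all add: regular_module_def)
  have chain_diff: "boundaries F (regular_module A) i j = Z i j" for i j
    using step(1)[of i] by (simp add: boundaries_def tensor_comp_eq_shift_sum tensor_diff_eq_lin_ext F reg covers_def)
  have aug: "aug_map scale A F f = augmentation scale A (lookup f 0)"
    if "f \<in> shift_sum {0} (\<lambda>_. 0) A j" for f j
  proof -
    have f: "f = single 0 (lookup f 0)"
      using shift_sumD(3)[OF that] by (intro poly_mapping_eqI) (auto simp: lookup_single when_def)
    show ?thesis
      by (subst f) (simp add: aug_map_def residue_field_def F)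
  qed
  have "is_free_resolution scale A F"
    unfolding is_free_resolution_def
  proof (intro conjI allI ballI)
    fix i b assume "b \<in> basis F (Suc i)"
    then show "diff F i b \<in> tensor_comp F (regular_module A) i (deg F (Suc i) b)"
      using step(1)[of i] Zsub[of i] by (auto simp: tensor_comp_eq_shift_sum F reg covers_def)
  next
    fix b assume "b \<in> basis F 0"
    then show "aug F b \<in> comp (residue_field scale A) (deg F 0 b)"
      by (simp add: F start residue_field_def)
  next
    fix j
    show "aug_map scale A F ` tensor_comp F (regular_module A) 0 j = comp (residue_field scale A) j"
    proof (cases "j = 0")
      case True
      have "c \<in> aug_map scale A F ` shift_sum {0} (\<lambda>_. 0) A 0" for c
      proof
        show "single 0 (scale c 1) \<in> shift_sum {0} (\<lambda>_. 0) A 0"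
          by (intro single_in_shift_sum[where l=0]) (auto simp: scalar_in_comp_zero comp_has_zero)
        from aug[OF this] show "c = aug_map scale A F (single 0 (scale c 1))" by simp
      qed
      then show ?thesis
        using True by (auto simp: tensor_comp_eq_shift_sum F start reg residue_field_def)
    next
      case False
      have "aug_map scale A F f = 0" if f: "f \<in> shift_sum {0} (\<lambda>_. 0) A j" for f
        using aug[OF f] shift_sumD(2)[OF f, of 0] augmentation_nonzero_degree[of "lookup f 0" j] False by auto
      moreover have "0 \<in> shift_sum {0} (\<lambda>_. 0) A j" by (intro shift_sumI) (auto simp: comp_has_zero)
      ultimately show ?thesis
        using False by (auto simp: tensor_comp_eq_shift_sum F start reg residue_field_def image_iff intro!: bexI[of _ 0])
    qed
  next
    fix j
    show "{f \<in> tensor_comp F (regular_module A) 0 j. aug_map scale A F f = 0} = boundaries F (regular_module A) 0 j"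
      unfolding chain_diff using aug by (auto simp: tensor_comp_eq_shift_sum F start reg)
  next
    fix i j
    show "cycles F (regular_module A) (Suc i) j = boundaries F (regular_module A) (Suc i) j"
      unfolding chain_diff step(2) by (simp add: cycles_def tensor_comp_eq_shift_sum tensor_diff_eq_lin_ext F reg)
  qed
  then show ?thesis by blast
qed

end

section \<open>The polynomial ring\<close>

definition monomial_degree :: "('r \<Rightarrow>\<^sub>0 nat) \<Rightarrow> int" where
  "monomial_degree m = int (\<Sum>x\<in>keys m. lookup m x)"

lemma sym_alg_eq: "sym_alg X j = {p. \<forall>m\<in>keys p. keys m \<subseteq> X \<and> monomial_degree m = j}"
  by (simp add: sym_alg_def monomial_degree_def)

lemma keys_add_nat: "keys (m + n :: 'r \<Rightarrow>\<^sub>0 nat) = keys m \<union> keys n"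
  by (auto simp: in_keys_iff lookup_add)

lemma monomial_degree_superset:
  "finite K \<Longrightarrow> keys m \<subseteq> K \<Longrightarrow> monomial_degree m = int (\<Sum>x\<in>K. lookup m x)"
  unfolding monomial_degree_def
  by (subst sum.mono_neutral_left[of K "keys m"]) (auto simp: in_keys_iff)

lemma monomial_degree_add: "monomial_degree (m + n) = monomial_degree m + monomial_degree n"
  by (simp add: monomial_degree_superset[of "keys m \<union> keys n"] keys_add_nat lookup_add sum.distrib)

lemma monomial_degree_nonneg: "0 \<le> monomial_degree m"
  unfolding monomial_degree_def by (rule of_nat_0_le_iff)

lemma monomial_degree_zero_iff: "monomial_degree m = 0 \<longleftrightarrow> m = 0"
proof
  assume "monomial_degree m = 0"
  then have "(\<Sum>x\<in>keys m. lookup m x) = 0" unfolding monomial_degree_def by linarith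
  then have "\<forall>x\<in>keys m. lookup m x = 0" by simp
  then show "m = 0" by (intro poly_mapping_eqI) (auto simp: in_keys_iff)
qed (simp add: monomial_degree_def)

lemma sum_singles: "(\<Sum>m\<in>keys p. single m (lookup p m)) = p"
  by (rule poly_mapping_eqI) (simp add: lookup_sum_single in_keys_iff)

lemma lookup_sym_scale: "lookup (sym_scale c p) m = c * lookup p m"
  by (simp add: sym_scale_def lookup_map flip: mult_map_scale_conv_mult)

lemma k_algebra_sym_scale: "k_algebra (sym_scale :: 'k::field \<Rightarrow> ('r, 'k) pol \<Rightarrow> _)"
  by unfold_locales
     (auto simp: sym_scale_def algebra_simps single_add mult_single simp flip: mult.assoc)

lemma sym_algD:
  assumes "p \<in> sym_alg X j" "m \<in> keys p" shows "keys m \<subseteq> X" "monomial_degree m = j"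
  using assms by (auto simp: sym_alg_eq)

lemma sym_alg_subset:
  assumes "p \<in> sym_alg X j" "keys q \<subseteq> keys p" shows "q \<in> sym_alg X j"
  using assms by (auto simp: sym_alg_eq)

lemma single_in_sym_alg: "keys m \<subseteq> X \<Longrightarrow> monomial_degree m = j \<Longrightarrow> single m c \<in> sym_alg X j"
  by (auto simp: sym_alg_eq)

lemma finite_monomials:
  assumes "finite X" shows "finite {m. keys m \<subseteq> X \<and> monomial_degree m = j}"
proof (rule finite_imageD)
  have "lookup m x \<le> nat j" if "keys m \<subseteq> X" "monomial_degree m = j" for m x
  proof (cases "x \<in> keys m")
    case True
    then have "lookup m x \<le> (\<Sum>x\<in>keys m. lookup m x)" by (intro member_le_sum) auto
    then show ?thesis using that(2) unfolding monomial_degree_def by linarith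
  qed (simp add: in_keys_iff)
  then have "lookup ` {m. keys m \<subseteq> X \<and> monomial_degree m = j}
      \<subseteq> {f. \<forall>x. (x \<in> X \<longrightarrow> f x \<in> {..nat j}) \<and> (x \<notin> X \<longrightarrow> f x = 0)}"
    by (auto simp: in_keys_iff)
  then show "finite (lookup ` {m. keys m \<subseteq> X \<and> monomial_degree m = j})"
    by (rule finite_subset) (intro finite_set_of_finite_funs assms finite_atMost)
  show "inj_on lookup {m. keys m \<subseteq> X \<and> monomial_degree m = j}"
    by (simp add: inj_on_def lookup_inject)
qed

lemma connected_sym_alg:
  assumes "finite X"
  shows "connected_algebra sym_scale (sym_alg X :: int \<Rightarrow> ('r, 'k::field) pol set)"
proof -
  interpret k_algebra "sym_scale :: 'k \<Rightarrow> ('r, 'k) pol \<Rightarrow> _" by (rule k_algebra_sym_scale)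
  show ?thesis
  proof
    fix i j :: int and c :: 'k and x y :: "('r, 'k) pol"
    have scalar: "sym_scale c 1 = single 0 c" for c :: 'k by (simp add: sym_scale_def)
    show "sym_alg X i = {0 :: ('r, 'k) pol}" if "i < 0"
    proof -
      have "keys p = {}" if "p \<in> sym_alg X i" for p :: "('r, 'k) pol"
        using sym_algD(2)[OF that] monomial_degree_nonneg \<open>i < 0\<close> by (metis all_not_in_conv not_le)
      then have "sym_alg X i \<subseteq> {0 :: ('r, 'k) pol}" by auto
      moreover have "0 \<in> sym_alg X i" by (simp add: sym_alg_eq)
      ultimately show ?thesis by auto
    qed
    show "subspace (sym_alg X i :: ('r, 'k) pol set)"
    proof (rule subspaceI)
      fix p q :: "('r, 'k) pol" assume "p \<in> sym_alg X i" "q \<in> sym_alg X i"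
      then show "p + q \<in> sym_alg X i" using keys_add[of p q] by (auto simp: sym_alg_eq)
    next
      fix c :: 'k and p :: "('r, 'k) pol" assume "p \<in> sym_alg X i"
      then show "sym_scale c p \<in> sym_alg X i"
        by (rule sym_alg_subset) (auto simp: in_keys_iff lookup_sym_scale)
    qed (simp add: sym_alg_eq)
    show "x * y \<in> sym_alg X (i + j)" if "x \<in> sym_alg X i" "y \<in> sym_alg X j"
      unfolding sym_alg_eq
    proof (intro CollectI ballI)
      fix m assume "m \<in> keys (x * y)"
      then obtain a b where "m = a + b" "a \<in> keys x" "b \<in> keys y" using keys_mult by blast
      then show "keys m \<subseteq> X \<and> monomial_degree m = i + j"
        using sym_algD[OF that(1)] sym_algD[OF that(2)] by (simp add: keys_add_nat monomial_degree_add)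
    qed
    show "sym_alg X 0 = range (\<lambda>c. sym_scale c 1 :: ('r, 'k) pol)"
    proof (intro equalityI subsetI)
      fix p :: "('r, 'k) pol" assume p: "p \<in> sym_alg X 0"
      have "keys p \<subseteq> {0}" using sym_algD(2)[OF p] monomial_degree_zero_iff by blast
      then have "p = single 0 (lookup p 0)"
        by (intro poly_mapping_eqI) (auto simp: lookup_single when_def in_keys_iff)
      then show "p \<in> range (\<lambda>c. sym_scale c 1)" by (auto simp: scalar)
    qed (auto simp: scalar monomial_degree_zero_iff intro!: single_in_sym_alg)
    show "c = 0" if "sym_scale c 1 \<in> span (\<Union>i\<in>{0<..}. sym_alg X i :: ('r, 'k) pol set)"
    proof -
      have "lookup p 0 = 0" if "p \<in> span (\<Union>i\<in>{0<..}. sym_alg X i)" for p :: "('r, 'k) pol"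
        using that
      proof (induction rule: span_induct_alt)
        case (step c x y)
        then obtain i where "0 < i" "x \<in> sym_alg X i" by auto
        then have "lookup x 0 = 0" using sym_algD(2)[of x X i 0] by (auto simp: in_keys_iff monomial_degree_def)
        then show ?case using step by (simp add: lookup_add lookup_sym_scale)
      qed simp
      from this[OF that] show ?thesis by (simp add: scalar)
    qed
    show "\<exists>W. finite W \<and> sym_alg X i \<subseteq> span (W :: ('r, 'k) pol set)"
    proof (intro exI conjI subsetI)
      let ?W = "(\<lambda>m. single m (1 :: 'k)) ` {m. keys m \<subseteq> X \<and> monomial_degree m = i}"
      show "finite ?W" by (intro finite_imageI finite_monomials assms)
      fix p :: "('r, 'k) pol" assume p: "p \<in> sym_alg X i"
      have "(\<Sum>m\<in>keys p. sym_scale (lookup p m) (single m 1)) \<in> span ?W"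
        using sym_algD[OF p] by (intro span_sum span_scale span_base) auto
      also have "(\<Sum>m\<in>keys p. sym_scale (lookup p m) (single m 1)) = p"
        by (simp add: sym_scale_def mult_single sum_singles)
      finally show "p \<in> span ?W" .
    qed
  qed
qed

subsection \<open>The canonical map\<close>

abbreviation monomial_value :: "('r::comm_ring_1 \<Rightarrow>\<^sub>0 nat) \<Rightarrow> 'r" where
  "monomial_value m \<equiv> \<Prod>x\<in>keys m. x ^ lookup m x"

lemma monomial_value_superset:
  "finite K \<Longrightarrow> keys m \<subseteq> K \<Longrightarrow> monomial_value m = (\<Prod>x\<in>K. x ^ lookup m x)"
  by (rule prod.mono_neutral_left) (auto simp: in_keys_iff)

lemma monomial_value_add: "monomial_value (m + n) = monomial_value m * monomial_value n"
  by (simp add: monomial_value_superset[of "keys m \<union> keys n"] keys_add_nat lookup_add power_add prod.distrib)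

context k_algebra
begin

lemma canonical_map_add: "canonical_map scale (p + q) = canonical_map scale p + canonical_map scale q"
  unfolding canonical_map_def
  by (rule setsum_keys_plus_distrib) (simp_all add: scale_left_distrib)

lemma additive_canonical_map: "additive (canonical_map scale)"
  by (simp add: additive_def canonical_map_add)

lemmas canonical_map_sum = additive.sum[OF additive_canonical_map]
lemmas canonical_map_zero [simp] = additive.zero[OF additive_canonical_map]

lemma canonical_map_single: "canonical_map scale (single m c) = scale c (monomial_value m)"
  by (simp add: canonical_map_def)

lemma canonical_map_mult: "canonical_map scale (p * q) = canonical_map scale p * canonical_map scale q"
proof -
  have "p * q = (\<Sum>m\<in>keys p. single m (lookup p m)) * (\<Sum>n\<in>keys q. single n (lookup q n))"
    by (simp add: sum_singles)
  also have "\<dots> = (\<Sum>m\<in>keys p. \<Sum>n\<in>keys q. single (m + n) (lookup p m * lookup q n))"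
    by (simp add: sum_product mult_single)
  finally have pq: "p * q = (\<Sum>m\<in>keys p. \<Sum>n\<in>keys q. single (m + n) (lookup p m * lookup q n))" .
  have sc: "scale (a * b) (x * y) = scale a x * scale b y" for a b x y
    by (metis scale_mult_left scale_scale mult.commute)
  show ?thesis
    unfolding pq canonical_map_sum canonical_map_single monomial_value_add sc
    by (simp add: canonical_map_def sum_product)
qed

lemma canonical_map_one [simp]: "canonical_map scale 1 = 1"
  using canonical_map_single[of 0 1] by simp

lemma module_canonical_map: "module (\<lambda>p x. canonical_map scale p * x)"
  by standard (auto simp: algebra_simps canonical_map_add canonical_map_mult)

end

context standard_graded_algebra
begin

lemma decomposition_unique:
  assumes "\<And>i. lookup x i \<in> R i" "\<And>i. lookup y i \<in> R i"
    "(\<Sum>i\<in>keys x. lookup x i) = (\<Sum>i\<in>keys y. lookup y i)"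
  shows "x = y"
  using direct_sum[of "\<Sum>i\<in>keys x. lookup x i"] assms by blast

lemma power_component: "x \<in> R 1 \<Longrightarrow> x ^ e \<in> R (int e)"
proof (induction e)
  case 0
  then show ?case using component_0 by (metis of_nat_0 power_0 rangeI scale_one)
next
  case (Suc e)
  then show ?case using mult_component[of x 1 "x ^ e" "int e"] by simp
qed

lemma monomial_value_component:
  assumes "X \<subseteq> R 1" "keys m \<subseteq> X" shows "monomial_value m \<in> R (monomial_degree m)"
proof -
  have "(\<Prod>x\<in>K. x ^ e x) \<in> R (int (\<Sum>x\<in>K. e x))" if "finite K" "K \<subseteq> X" for K and e :: "'a \<Rightarrow> nat"
    using that
  proof (induction K)
    case empty
    then show ?case using component_0 by (metis of_nat_0 prod.empty sum.empty rangeI scale_one)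
  next
    case (insert x K)
    then show ?case
      using mult_component[OF power_component[of x "e x"]] assms(1) by auto
  qed
  then show ?thesis using assms(2) by (auto simp: monomial_degree_def simp del: of_nat_sum)
qed

lemma canonical_map_component:
  assumes "X \<subseteq> R 1" "p \<in> sym_alg X j" shows "canonical_map scale p \<in> R j"
  unfolding canonical_map_def
  using sym_algD[OF assms(2)] monomial_value_component[OF assms(1)] subspace_component
  by (intro subspace_sum subspace_scale) metis+

text \<open>The image is a subalgebra that contains \<open>R\<^sub>1\<close>.\<close>

lemma canonical_map_surj_ungraded:
  assumes "span X = R 1"
  shows "\<exists>p :: ('a, 'k) pol. (\<forall>m\<in>keys p. keys m \<subseteq> X) \<and> canonical_map scale p = r"
proof -
  define P :: "('a, 'k) pol set" where "P = {p. \<forall>m\<in>keys p. keys m \<subseteq> X}"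
  have P_add: "p + q \<in> P" if "p \<in> P" "q \<in> P" for p q
    using that keys_add[of p q] by (auto simp: P_def)
  have P_mult: "p * q \<in> P" if pq: "p \<in> P" "q \<in> P" for p q
    unfolding P_def
  proof (intro CollectI ballI)
    fix m assume "m \<in> keys (p * q)"
    then obtain a b where "m = a + b" "a \<in> keys p" "b \<in> keys q" using keys_mult by blast
    then show "keys m \<subseteq> X" using pq by (simp add: P_def keys_add_nat)
  qed
  have P_single: "single m c \<in> P" if "keys m \<subseteq> X" for m c
    using that by (auto simp: P_def)
  define T where "T = canonical_map scale ` P"
  have T_scalar: "scale c 1 \<in> T" for c
    unfolding T_def by (rule image_eqI[of _ _ "single 0 c"]) (auto simp: canonical_map_single P_single)
  have T_add: "x + y \<in> T" if "x \<in> T" "y \<in> T" for x y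
    using that P_add by (auto simp: T_def canonical_map_add[symmetric])
  have T_mult: "x * y \<in> T" if "x \<in> T" "y \<in> T" for x y
    using that P_mult by (auto simp: T_def canonical_map_mult[symmetric])
  have T_sub: "subspace T"
  proof (rule subspaceI)
    show "0 \<in> T" using T_scalar[of 0] by simp
    show "scale c x \<in> T" if "x \<in> T" for c x
      using T_mult[OF T_scalar[of c] that] by (simp add: scale_mult_left[symmetric])
  qed (rule T_add)
  have "X \<subseteq> T"
  proof
    fix x assume "x \<in> X"
    then show "x \<in> T"
      unfolding T_def
      by (intro image_eqI[of _ _ "single (single x 1) 1"]) (auto simp: canonical_map_single P_single)
  qed
  then have "R 1 \<subseteq> T" using span_minimal[OF _ T_sub] assms by blast
  then have "UNIV \<subseteq> T"
    unfolding generated[symmetric] using T_sub T_mult T_scalar[of 1] by (intro hull_minimal) auto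
  then obtain p where "p \<in> P" "r = canonical_map scale p" by (auto simp: T_def)
  then show ?thesis by (auto simp: P_def)
qed

text \<open>
  In a preimage \<open>p\<close> of an element of degree \<open>j\<close>, only the part of degree \<open>j\<close> counts, as the decomposition into
  homogeneous elements is unique in \<open>R\<close>.
\<close>

lemma canonical_map_surj:
  assumes X: "span X = R 1" and r: "r \<in> R j"
  shows "\<exists>p\<in>sym_alg X j. canonical_map scale p = r"
proof -
  obtain p :: "('a, 'k) pol" where p: "\<And>m. m \<in> keys p \<Longrightarrow> keys m \<subseteq> X" "canonical_map scale p = r"
    using canonical_map_surj_ungraded[OF X] by blast
  have XR: "X \<subseteq> R 1" using span_superset X by blast
  define q where "q i = (\<Sum>m | m \<in> keys p \<and> monomial_degree m = i. single m (lookup p m))" for i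
  have q: "q i \<in> sym_alg X i" for i
  proof -
    have "keys (q i) \<subseteq> {m \<in> keys p. monomial_degree m = i}"
      unfolding q_def by (rule order_trans[OF keys_sum]) auto
    then show ?thesis using p(1) by (auto simp: sym_alg_eq)
  qed
  define D where "D = monomial_degree ` keys p"
  have finD: "finite D" by (simp add: D_def)
  define f where "f = (\<Sum>i\<in>D. single i (canonical_map scale (q i)))"
  have q0: "q i = 0" if "i \<notin> D" for i
  proof -
    have "{m. m \<in> keys p \<and> monomial_degree m = i} = {}" using that by (auto simp: D_def)
    then show ?thesis unfolding q_def by (metis sum.empty)
  qed
  have f: "lookup f i = canonical_map scale (q i)" for i
    using q0 by (simp add: f_def lookup_sum_single finD)
  have "(\<Sum>i\<in>keys f. lookup f i) = (\<Sum>i\<in>D. canonical_map scale (q i))"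
    unfolding f[symmetric] using finD q0 f by (intro sum.mono_neutral_left) (force simp: in_keys_iff)+
  also have "\<dots> = canonical_map scale (\<Sum>i\<in>D. q i)" by (simp add: canonical_map_sum)
  also have "(\<Sum>i\<in>D. q i) = p"
  proof -
    have "(\<Sum>i\<in>D. q i) = (\<Sum>m\<in>keys p. single m (lookup p m))"
      unfolding q_def D_def by (rule sum.image_gen[symmetric]) simp
    then show ?thesis by (simp add: sum_singles)
  qed
  finally have sum_f: "(\<Sum>i\<in>keys f. lookup f i) = r" by (simp add: p(2))
  have "f = single j r"
  proof (rule decomposition_unique)
    show "lookup f i \<in> R i" for i unfolding f using canonical_map_component[OF XR q] .
    show "lookup (single j r) i \<in> R i" for i
      using r by (auto simp: lookup_single when_def subspace_0 subspace_component)
    show "(\<Sum>i\<in>keys f. lookup f i) = (\<Sum>i\<in>keys (single j r). lookup (single j r) i)"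
      by (simp add: sum_f)
  qed
  then have "canonical_map scale (q j) = r" using f[of j] by simp
  then show ?thesis using q by blast
qed

text \<open>
  Finite rank is inherited from the polynomial ring, and the uniqueness of decompositions separates
  \<open>k\<close> from the positive components.
\<close>

lemma standard_graded_connected:
  assumes X: "finite X" "span X = R 1"
  shows "connected_algebra scale R"
proof
  fix i
  show "\<exists>W. finite W \<and> R i \<subseteq> span W"
  proof (intro exI conjI subsetI)
    let ?W = "monomial_value ` {m. keys m \<subseteq> X \<and> monomial_degree m = i}"
    show "finite ?W" by (intro finite_imageI finite_monomials X)
    fix r assume "r \<in> R i"
    then obtain p :: "('a, 'k) pol" where p: "p \<in> sym_alg X i" "canonical_map scale p = r"
      using canonical_map_surj[OF X(2)] by blast
    have "canonical_map scale p \<in> span ?W"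
      unfolding canonical_map_def using sym_algD[OF p(1)] by (intro span_sum span_scale span_base) auto
    then show "r \<in> span ?W" by (simp add: p)
  qed
next
  fix c assume "scale c 1 \<in> span (\<Union>i\<in>{0<..}. R i)"
  moreover have "\<exists>x. (\<forall>i. lookup x i \<in> R i) \<and> lookup x 0 = 0 \<and> a = (\<Sum>i\<in>keys x. lookup x i)"
    if "a \<in> span (\<Union>i\<in>{0<..}. R i)" for a
    using that
  proof (induction rule: span_induct_alt)
    case base
    then show ?case by (intro exI[of _ 0]) (auto simp: subspace_0 subspace_component)
  next
    case (step c v w)
    then obtain i x where i: "0 < i" "v \<in> R i"
      and x: "\<forall>i. lookup x i \<in> R i" "lookup x 0 = 0" "w = (\<Sum>i\<in>keys x. lookup x i)" by auto
    have "(\<Sum>k\<in>keys (single i (scale c v) + x). lookup (single i (scale c v) + x) k)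
        = (\<Sum>k\<in>keys (single i (scale c v)). lookup (single i (scale c v)) k) + w"
      unfolding x(3) by (rule setsum_keys_plus_distrib) auto
    then show ?case
      using i x(1,2)
      by (intro exI[of _ "single i (scale c v) + x"])
         (auto simp: lookup_add lookup_single when_def
           intro!: subspace_add subspace_component subspace_scale)
  qed
  ultimately obtain x where x: "\<And>i. lookup x i \<in> R i" "lookup x 0 = 0" "scale c 1 = (\<Sum>i\<in>keys x. lookup x i)"
    by blast
  have "lookup (single 0 (scale c 1)) i \<in> R i" for i
    by (cases "i = 0") (auto simp: lookup_single component_0 subspace_0 subspace_component)
  then have "x = single 0 (scale c 1)"
    using x(3) by (intro decomposition_unique x) auto
  then show "c = 0" using x(2) by simp
qed (auto simp: negative subspace_component mult_component component_0)

end

section \<open>The residue field over the polynomial ring\<close>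

text \<open>
  The ideal generated by the variables in \<open>Y\<close> is a monomial ideal: a polynomial lies in it if and only if each of
  its monomials involves a variable of \<open>Y\<close>.
\<close>

definition variable_ideal :: "'r set \<Rightarrow> 'r set \<Rightarrow> int \<Rightarrow> ('r, 'k::field) pol set" where
  "variable_ideal X Y j = {p \<in> sym_alg X j. \<forall>m\<in>keys p. keys m \<inter> Y \<noteq> {}}"

abbreviation var :: "'r \<Rightarrow> ('r, 'k::field) pol" where
  "var x \<equiv> single (single x (Suc 0)) 1"

lemma lookup_var_times: "lookup (var x * p) (single x (Suc 0) + m) = lookup p m"
proof -
  have "var x * p = (\<Sum>n\<in>keys p. single (single x (Suc 0) + n) (lookup p n))"
  proof -
    have "var x * p = var x * (\<Sum>n\<in>keys p. single n (lookup p n))" by (simp add: sum_singles)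
    then show ?thesis by (simp add: sum_distrib_left mult_single)
  qed
  then have "lookup (var x * p) (single x (Suc 0) + m) = (\<Sum>n\<in>keys p. if n = m then lookup p n else 0)"
    by (simp add: lookup_sum lookup_single when_def)
  then show ?thesis by (simp add: in_keys_iff)
qed

text \<open>The variables form a regular sequence.\<close>

lemma var_nonzerodivisor:
  assumes "x \<notin> Y" "w \<in> sym_alg X l" "var x * w \<in> variable_ideal X Y j"
  shows "w \<in> variable_ideal X Y l"
proof -
  have "keys m \<inter> Y \<noteq> {}" if "m \<in> keys w" for m
  proof -
    have "single x (Suc 0) + m \<in> keys (var x * w)" using that by (simp add: in_keys_iff lookup_var_times)
    then have "keys (single x (Suc 0) + m) \<inter> Y \<noteq> {}" using assms(3) by (auto simp: variable_ideal_def)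
    then show ?thesis using assms(1) by (auto simp: keys_add_nat)
  qed
  then show ?thesis using assms(2) by (simp add: variable_ideal_def)
qed

lemma monomial_degree_single [simp]: "monomial_degree (single x (Suc 0)) = 1"
  by (simp add: monomial_degree_def)

lemma var_in_sym_alg: "x \<in> X \<Longrightarrow> var x \<in> sym_alg X 1"
  by (intro single_in_sym_alg) simp_all

text \<open>Divide by \<open>x\<close> the monomials that involve no variable of \<open>Y\<close>; all of these contain \<open>x\<close>.\<close>

lemma variable_ideal_insert:
  fixes p :: "('r, 'k::field) pol"
  assumes p: "p \<in> variable_ideal X (insert x Y) j"
  shows "\<exists>v\<in>sym_alg X (j - 1). p - var x * v \<in> variable_ideal X Y j"
proof -
  define K where "K = {m \<in> keys p. keys m \<inter> Y = {}}"
  have x: "x \<in> keys m" if "m \<in> K" for m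
    using that p by (auto simp: K_def variable_ideal_def)
  have split_m: "single x (Suc 0) + (m - single x (Suc 0)) = m" if "m \<in> K" for m
    using x[OF that] by (intro poly_mapping_eqI) (auto simp: lookup_add lookup_minus lookup_single when_def in_keys_iff)
  define v where "v = (\<Sum>m\<in>K. single (m - single x (Suc 0)) (lookup p m))"
  have sym: "p \<in> sym_alg X j" using p by (simp add: variable_ideal_def)
  have v: "v \<in> sym_alg X (j - 1)"
    unfolding sym_alg_eq
  proof (intro CollectI ballI)
    fix n assume "n \<in> keys v"
    then have "n \<in> (\<Union>m\<in>K. keys (single (m - single x (Suc 0)) (lookup p m)))"
      unfolding v_def by (rule subsetD[OF keys_sum])
    then obtain m where m: "m \<in> K" "n \<in> keys (single (m - single x (Suc 0)) (lookup p m))" by (rule UN_E)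
    from m(2) have "n = m - single x (Suc 0)" by (simp split: if_splits)
    then have m_eq: "m = single x (Suc 0) + n" using split_m[OF m(1)] by simp
    have "m \<in> keys p" using m(1) by (simp add: K_def)
    then have "keys m \<subseteq> X" "monomial_degree m = j" using sym_algD[OF sym] by auto
    then show "keys n \<subseteq> X \<and> monomial_degree n = j - 1"
      unfolding m_eq keys_add_nat monomial_degree_add by simp
  qed
  have "var x * v = (\<Sum>m\<in>K. single m (lookup p m))"
    by (simp add: v_def sum_distrib_left mult_single split_m)
  then have look: "lookup (p - var x * v) m = (if m \<in> K then 0 else lookup p m)" for m
    by (simp add: lookup_minus lookup_sum_single K_def)
  have "keys (p - var x * v) = keys p - K"
    by (auto simp: in_keys_iff look split: if_splits)
  then have "p - var x * v \<in> variable_ideal X Y j"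
    using sym sym_alg_subset[OF sym, of "p - var x * v"] by (auto simp: variable_ideal_def K_def)
  with v show ?thesis by blast
qed

locale resolved_sym_alg = resolved_algebra sym_scale "sym_alg X" F
  for X :: "'r set" and F :: "(('r, 'k::field) pol, 'k) free_complex"
begin

sublocale tensored_resolution sym_scale "sym_alg X" F "(*)"
  by (simp add: tensored_resolution_def resolved_algebra_axioms module_times)

lemma graded_submodule_variable_ideal: "graded_submodule (sym_alg X) (*) (variable_ideal X Y :: int \<Rightarrow> ('r, 'k) pol set)"
proof (rule graded_submoduleI)
  fix j and u v :: "('r, 'k) pol" assume "u \<in> variable_ideal X Y j" "v \<in> (variable_ideal X Y j :: ('r, 'k) pol set)"
  then show "u - v \<in> variable_ideal X Y j"
    using keys_diff[of u v] graded_submodule_diff[OF graded_submodule_self]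
    by (auto simp: variable_ideal_def)
next
  fix i j and a v :: "('r, 'k) pol" assume a: "a \<in> sym_alg X i" and v: "v \<in> variable_ideal X Y j"
  have "keys m \<inter> Y \<noteq> {}" if "m \<in> keys (a * v)" for m
  proof -
    obtain m1 m2 where "m = m1 + m2" "m1 \<in> keys a" "m2 \<in> keys v" using \<open>m \<in> keys (a * v)\<close> keys_mult by blast
    then show ?thesis using v by (auto simp: variable_ideal_def keys_add_nat)
  qed
  then show "a * v \<in> variable_ideal X Y (i + j)"
    using comp_times[OF a] v by (auto simp: variable_ideal_def)
qed (simp add: variable_ideal_def comp_has_zero)

text \<open>
  \<open>Tor\<^sub>m(k, S / (Y))\<close> is zero in degrees above \<open>m\<close>, by induction on \<open>Y\<close> with the exact sequence
  \<open>0 \<rightarrow> (S / (Y))(-1) \<rightarrow> S / (Y) \<rightarrow> S / (Y, x) \<rightarrow> 0\<close>: the shift by one degree is matched by the drop of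
  the homological degree in \<open>Tor\<^sub>m(S / (Y, x)) \<rightarrow> Tor\<^sub>m\<^sub>-\<^sub>1((S / (Y))(-1))\<close>. For \<open>Y = X\<close> this bounds
  \<open>Tor\<^sub>m(k, k)\<close>, whatever the resolution \<open>F\<close>.
\<close>

lemma variable_quotient_tor_vanishes:
  fixes f :: "nat \<Rightarrow>\<^sub>0 ('r, 'k) pol"
  assumes "finite Y" "Y \<subseteq> X" "int m < j" "f \<in> tc (sym_alg X) m j"
    "\<And>m'. m = Suc m' \<Longrightarrow> d (*) m' f \<in> tc (variable_ideal X Y) m' j"
  shows "\<exists>g\<in>tc (sym_alg X) (Suc m) j. f - d (*) m g \<in> tc (variable_ideal X Y) m j"
  using assms
proof (induction Y arbitrary: m j f rule: finite_induct)
  case empty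
  have I: "variable_ideal X {} l = {0 :: ('r, 'k) pol}" for l
  proof -
    have "p = 0" if "p \<in> variable_ideal X {} l" for p :: "('r, 'k) pol"
      using that keys_eq_empty[of p] by (auto simp: variable_ideal_def)
    then show ?thesis by (auto simp: variable_ideal_def comp_has_zero)
  qed
  have "\<exists>g\<in>tc (sym_alg X) (Suc m) j. d (*) m g = f"
  proof (cases m)
    case 0
    then have "aug_map sym_scale (sym_alg X) F f = 0"
      using empty by (intro aug_map_nonzero_degree) auto
    then have "f \<in> d (*) 0 ` tc (sym_alg X) (Suc 0) j"
      using empty 0 unfolding aug_exact[symmetric] by simp
    then show ?thesis using 0 by auto
  next
    case (Suc m')
    have df: "d (*) m' f \<in> tc (variable_ideal X {}) m' j" using empty(4)[OF Suc] .
    have "d (*) m' f = 0"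
    proof (rule poly_mapping_eqI)
      fix b show "lookup (d (*) m' f) b = lookup 0 b"
        using shift_sum_lookup[OF df, of b] by (simp add: I)
    qed
    then show ?thesis using exact_Suc empty(3) Suc by blast
  qed
  then obtain g where g: "g \<in> tc (sym_alg X) (Suc m) j" "f - d (*) m g = 0" by auto
  have "f - d (*) m g \<in> tc (variable_ideal X {}) m j" unfolding g(2) by (rule shift_sumI) (simp_all add: I)
  with g(1) show ?case by blast
next
  case (insert x Y)
  have x: "x \<in> X" and YX: "Y \<subseteq> X" using insert.prems by auto
  let ?S = "sym_alg X :: int \<Rightarrow> ('r, 'k) pol set"
  let ?I = "variable_ideal X Y :: int \<Rightarrow> ('r, 'k) pol set"
  let ?J = "variable_ideal X (insert x Y) :: int \<Rightarrow> ('r, 'k) pol set"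
  let ?x = "Poly_Mapping.map ((*) (var x :: ('r, 'k) pol)) :: (nat \<Rightarrow>\<^sub>0 ('r, 'k) pol) \<Rightarrow> _"
  note gr = graded_submodule_tc[OF graded_submodule_self]
  note grI = graded_submodule_tc[OF graded_submodule_variable_ideal]
  have d_x: "d (*) i (?x g) = ?x (d (*) i g)" for i g
    by (intro lin_ext_natural) (simp_all add: module_times additive_def distrib_left mult.left_commute)
  have IJ: "tc ?I i l \<subseteq> tc ?J i l" for i l
  proof (rule shift_sum_mono)
    show "?I l \<subseteq> ?J l" for l unfolding variable_ideal_def by blast
  qed
  have xJ: "?x g \<in> tc ?J i (l + 1)" if "g \<in> tc ?S i l" for g i l
  proof (rule shift_sumI)
    fix b assume b: "b \<in> basis F i"
    have "var x \<in> variable_ideal X (insert x Y) 1"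
      using var_in_sym_alg[OF x] by (auto simp: variable_ideal_def)
    from graded_submodule_act[OF graded_submodule_variable_ideal shift_sumD(2)[OF that b] this refl]
    have "var x * lookup g b \<in> ?J (l - deg F i b + 1)" by (simp add: mult.commute)
    then show "lookup (?x g) b \<in> ?J (l + 1 - deg F i b)" by (simp add: lookup_map algebra_simps)
  qed (simp add: lookup_map shift_sumD(3)[OF that])
  have xS: "?x g \<in> tc ?S i (l + 1)" if "g \<in> tc ?S i l" for g i l
    using xJ[OF that] by (auto simp: shift_sum_def variable_ideal_def)
  \<comment> \<open>It suffices to change \<open>f\<close> by a multiple of \<open>x\<close> into a cycle modulo \<open>(Y)\<close>.\<close>
  have finish: ?case if f': "f - ?x g \<in> tc ?S m j" "g \<in> tc ?S m (j - 1)"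
     "\<And>m'. m = Suc m' \<Longrightarrow> d (*) m' (f - ?x g) \<in> tc ?I m' j" for g
  proof -
    obtain h where h: "h \<in> tc ?S (Suc m) j" "f - ?x g - d (*) m h \<in> tc ?I m j"
      using insert.IH[OF YX insert.prems(2) f'(1,3)] by blast
    have "(f - ?x g - d (*) m h) + ?x g \<in> tc ?J m j"
      using h(2) IJ xJ[OF f'(2)] by (intro graded_submodule_add[OF grI]) auto
    then show ?case using h(1) by (intro bexI[of _ h]) (auto simp: algebra_simps)
  qed
  show ?case
  proof (cases m)
    case 0
    show ?thesis
    proof (rule finish[of 0])
      have "?x 0 = 0" by (simp add: map_eq_zero_iff)
      then show "f - ?x 0 \<in> tc ?S m j" using insert.prems(3) by simp
    qed (simp_all add: 0 graded_submodule_zero[OF gr])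
  next
    case (Suc m')
    let ?df = "d (*) m' f"
    have df: "?df \<in> tc ?J m' j" using insert.prems(4)[OF Suc] .
    \<comment> \<open>Write \<open>d f = u + x V\<close> with \<open>u\<close> in \<open>(Y)\<close>; then \<open>V\<close> represents the image of \<open>f\<close> under the connecting map.\<close>
    have "\<forall>b. \<exists>v. b \<in> keys ?df \<longrightarrow> v \<in> ?S (j - deg F m' b - 1) \<and> lookup ?df b - var x * v \<in> ?I (j - deg F m' b)"
      using variable_ideal_insert shift_sumD(2)[OF df] shift_sumD(1)[OF df] by meson
    then obtain v where v: "\<And>b. b \<in> keys ?df \<Longrightarrow> v b \<in> ?S (j - deg F m' b - 1)"
       "\<And>b. b \<in> keys ?df \<Longrightarrow> lookup ?df b - var x * v b \<in> ?I (j - deg F m' b)"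
      by metis
    define V where "V = (\<Sum>b\<in>keys ?df. single b (v b))"
    have V: "lookup V b = (if b \<in> keys ?df then v b else 0)" for b
      by (simp add: V_def lookup_sum_single)
    have V_in: "V \<in> tc ?S m' (j - 1)"
      using shift_sumD(1)[OF df] v(1) by (intro shift_sumI) (auto simp: V comp_has_zero algebra_simps)
    have U_in: "?df - ?x V \<in> tc ?I m' j"
      using shift_sumD(1)[OF df] v(2) graded_submodule_zero[OF graded_submodule_variable_ideal]
      by (intro shift_sumI) (auto simp: lookup_minus lookup_map V in_keys_iff)
    have "\<exists>g\<in>tc ?S (Suc m') (j - 1). V - d (*) m' g \<in> tc ?I m' (j - 1)"
    proof (rule insert.IH[OF YX _ V_in])
      show "int m' < j - 1" using insert.prems(2) Suc by simp
      fix m'' assume m'': "m' = Suc m''"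
      have "f \<in> tc ?S (Suc (Suc m'')) j" using insert.prems(3) Suc m'' by simp
      then have "d (*) m'' ?df = 0" unfolding m'' by (rule d_d)
      then have "?x (d (*) m'' V) = - d (*) m'' (?df - ?x V)"
        by (simp add: N.lin_ext_diff d_x)
      then have xdV: "?x (d (*) m'' V) \<in> tc ?I m'' j"
        using graded_submodule_minus[OF grI d_in[OF graded_submodule_variable_ideal]] U_in m'' by metis
      have dV: "d (*) m'' V \<in> tc ?S m'' (j - 1)"
        using d_in[OF graded_submodule_self] V_in m'' by simp
      show "d (*) m'' V \<in> tc ?I m'' (j - 1)"
      proof (rule shift_sumI)
        fix b assume b: "b \<in> basis F m''"
        have "var x * lookup (d (*) m'' V) b \<in> ?I (j - deg F m'' b)"
          using shift_sumD(2)[OF xdV b] by (simp add: lookup_map)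
        then show "lookup (d (*) m'' V) b \<in> ?I (j - 1 - deg F m'' b)"
          by (rule var_nonzerodivisor[OF insert.hyps(2) shift_sumD(2)[OF dV b]])
      qed (rule shift_sumD(3)[OF dV])
    qed
    then obtain g where g: "g \<in> tc ?S (Suc m') (j - 1)" "V - d (*) m' g \<in> tc ?I m' (j - 1)" by blast
    show ?thesis
    proof (rule finish[of g])
      show "g \<in> tc ?S m (j - 1)" using g Suc by simp
      then show "f - ?x g \<in> tc ?S m j"
        using xS[of g m "j - 1"] insert.prems(3) by (intro graded_submodule_diff[OF gr]) auto
      fix m1 assume "m = Suc m1"
      then have m1: "m1 = m'" using Suc by simp
      have "?x (V - d (*) m' g) \<in> tc ?I m' j"
        using graded_submodule_act[OF grI var_in_sym_alg[OF x] g(2), of j] by simp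
      then have "(?df - ?x V) + ?x (V - d (*) m' g) \<in> tc ?I m' j"
        using U_in by (intro graded_submodule_add[OF grI])
      also have "(?df - ?x V) + ?x (V - d (*) m' g) = d (*) m' (f - ?x g)"
        by (rule poly_mapping_eqI) (simp add: N.lin_ext_diff d_x lookup_add lookup_minus lookup_map algebra_simps)
      finally show "d (*) m1 (f - ?x g) \<in> tc ?I m1 j" by (simp add: m1)
    qed
  qed
qed

end

section \<open>The homology of the base change\<close>

text \<open>
  \<open>F\<close> resolves \<open>k\<close> over \<open>S\<close> and \<open>G\<close> resolves \<open>k\<close> over \<open>R\<close>. The complex \<open>C = F \<otimes>\<^sub>S R\<close> is written with \<open>R\<close> as an
  \<open>S\<close>-module, and its terms serve as coefficient modules for \<open>G\<close>, with \<open>R\<close> acting on coordinates.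
\<close>

locale resolved_standard_algebra =
  standard_graded_algebra scale R + S: resolved_sym_alg X F + G: resolved_algebra scale R G
  for scale :: "'k::field \<Rightarrow> 'r::comm_ring_1 \<Rightarrow> 'r" and R X
    and F :: "(('r, 'k) pol, 'k) free_complex" and G +
  assumes finite_X: "finite X" and span_X: "span X = R 1"
begin

abbreviation "\<pi> \<equiv> canonical_map scale"
abbreviation "canonical_act \<equiv> (\<lambda>p x. \<pi> p * x)"

lemma variables_in_R: "X \<subseteq> R 1" using span_superset span_X by blast

sublocale C: tensored_resolution sym_scale "sym_alg X" F canonical_act
  by (simp add: tensored_resolution_def S.resolved_algebra_axioms module_canonical_map)

sublocale D: tensored_resolution scale R G G.smul
  by (simp add: tensored_resolution_def G.resolved_algebra_axioms module_pointwise module_times)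

lemma graded_submodule_R: "graded_submodule (sym_alg X) canonical_act R"
  using G.graded_submodule_self canonical_map_component[OF variables_in_R]
  by (auto simp: graded_submodule_def)

abbreviation "chain_comp p \<equiv> S.tc R p"
abbreviation "chain_diff p \<equiv> S.d canonical_act p"

definition Z :: "nat \<Rightarrow> int \<Rightarrow> (nat \<Rightarrow>\<^sub>0 'r) set" where
  "Z p j = {z \<in> chain_comp p j. \<forall>p'. p = Suc p' \<longrightarrow> chain_diff p' z = 0}"

definition B :: "nat \<Rightarrow> int \<Rightarrow> (nat \<Rightarrow>\<^sub>0 'r) set" where
  "B p j = chain_diff p ` chain_comp (Suc p) j"

lemma Z_0: "Z 0 = chain_comp 0" by (simp add: Z_def fun_eq_iff)

lemma Z_Suc: "Z (Suc p) = (\<lambda>j. {z \<in> chain_comp (Suc p) j. chain_diff p z = 0})" by (simp add: Z_def fun_eq_iff)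

lemma chain_diff_smul: "chain_diff p (G.smul r z) = G.smul r (chain_diff p z)"
  by (rule lin_ext_natural[OF C.N.module_axioms C.N.module_axioms])
    (simp_all add: additive_def distrib_left mult.left_commute)

lemma graded_submodule_chain_comp: "graded_submodule R G.smul (chain_comp p)"
  by (intro graded_submodule_shift_sum G.graded_submodule_self module_times)

lemma graded_submodule_Z: "graded_submodule R G.smul (Z p)"
  using graded_submodule_chain_comp[of p]
  by (auto simp: graded_submodule_def Z_def chain_diff_smul C.N.lin_ext_diff)

lemma graded_submodule_B: "graded_submodule R G.smul (B p)"
proof (rule graded_submoduleI)
  note gr = graded_submodule_chain_comp[of "Suc p"]
  show "0 \<in> B p j" for j
    unfolding B_def by (rule image_eqI[of _ _ 0]) (simp_all add: graded_submodule_zero[OF gr])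
  fix j u v assume "u \<in> B p j" "v \<in> B p j"
  then show "u - v \<in> B p j"
    unfolding B_def by (auto simp: C.N.lin_ext_diff[symmetric] intro!: imageI graded_submodule_diff[OF gr])
next
  note gr = graded_submodule_chain_comp[of "Suc p"]
  fix i j a v assume "a \<in> R i" "v \<in> B p j"
  then show "G.smul a v \<in> B p (i + j)"
    unfolding B_def by (auto simp: chain_diff_smul[symmetric] intro!: imageI graded_submodule_act[OF gr])
qed

lemma B_subset_Z: "B p j \<subseteq> Z p j"
  using C.d_in[OF graded_submodule_R] C.d_d by (auto simp: B_def Z_def)

lemma positive_part_kills_homology:
  assumes "a \<in> R i" "0 < i" "v \<in> Z p l"
  shows "G.smul a v \<in> B p (i + l)"
proof -
  obtain q where q: "q \<in> sym_alg X i" "\<pi> q = a"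
    using canonical_map_surj[OF span_X assms(1)] by blast
  obtain w where "w \<in> chain_comp (Suc p) (l + i)" "chain_diff p w = Poly_Mapping.map (canonical_act q) v"
    using C.positive_degree_kills_homology[OF graded_submodule_R q(1) assms(2), of v p l] assms(3)
    by (auto simp: Z_def)
  then show ?thesis
    unfolding B_def by (intro image_eqI[of _ _ w]) (simp_all add: q(2) add.commute)
qed

text \<open>
  The kernel of \<open>S \<rightarrow> R\<close> lies in \<open>S\<^sub>+\<close>, as the map is injective in degree \<open>0\<close>.
\<close>

lemma kernel_in_variable_ideal:
  assumes q: "q \<in> sym_alg X l" "\<pi> q = 0" shows "q \<in> variable_ideal X X l"
proof (cases "l = 0")
  case True
  then obtain c where "q = sym_scale c 1" using q(1) S.comp_zero by auto
  then have "q = single 0 c" by (simp add: sym_scale_def)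
  then have "q = 0" using q(2) by (simp add: canonical_map_single)
  then show ?thesis by (simp add: variable_ideal_def S.comp_has_zero)
next
  case False
  have "keys m \<inter> X \<noteq> {}" if "m \<in> keys q" for m
  proof -
    have "keys m \<subseteq> X" "monomial_degree m \<noteq> 0" using sym_algD[OF q(1) that] False by auto
    moreover from this have "keys m \<noteq> {}" by (auto simp: monomial_degree_zero_iff)
    ultimately show ?thesis by blast
  qed
  then show ?thesis using q(1) by (simp add: variable_ideal_def)
qed

lemma variable_ideal_nonpositive:
  assumes "q \<in> variable_ideal X X l" "l \<le> 0" shows "q = 0"
proof -
  have "m \<notin> keys q" for m
  proof
    assume m: "m \<in> keys q"
    then have "monomial_degree m = l" "keys m \<inter> X \<noteq> {}"
      using assms(1) sym_algD(2)[of q X l m] by (auto simp: variable_ideal_def)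
    then show False
      using assms(2) monomial_degree_nonneg[of m] monomial_degree_zero_iff[of m] by auto
  qed
  then show ?thesis using keys_eq_empty[of q] by blast
qed

text \<open>
  A cycle of degree \<open>j > p\<close> lifts to a chain of \<open>F\<close> that is a cycle modulo \<open>S\<^sub>+\<close>. Since \<open>Tor\<^sub>p\<^sup>S(k, k)\<close> is zero in
  degree \<open>j\<close>, it is a boundary modulo \<open>S\<^sub>+\<close>. So the cycle is homologous to one whose
  nonzero coordinates all have positive degree.
\<close>

lemma cycle_minimal_representative:
  assumes z: "z \<in> Z p j" and j: "int p < j"
  shows "\<exists>w\<in>chain_comp (Suc p) j. \<forall>c. j - deg F p c \<le> 0 \<longrightarrow> lookup (z - chain_diff p w) c = 0"
proof -
  have nat: "lin_ext canonical_act \<phi> (Poly_Mapping.map \<pi> f) = Poly_Mapping.map \<pi> (lin_ext (*) \<phi> f)" for \<phi> and f :: "nat \<Rightarrow>\<^sub>0 ('r, 'k) pol"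
    by (intro lin_ext_natural)
       (auto simp: module_times C.N.module_axioms additive_canonical_map canonical_map_mult)
  have surj: "R l \<subseteq> \<pi> ` sym_alg X l" for l
    using canonical_map_surj[OF span_X] by blast
  obtain f where f: "f \<in> S.tc (sym_alg X) p j" "Poly_Mapping.map \<pi> f = z"
    using shift_sum_lift[of z "basis F p" "deg F p" R j \<pi> "sym_alg X"] surj z S.comp_has_zero
    by (auto simp: Z_def)
  have "\<exists>g\<in>S.tc (sym_alg X) (Suc p) j. f - S.d (*) p g \<in> S.tc (variable_ideal X X) p j"
  proof (rule S.variable_quotient_tor_vanishes[OF finite_X order.refl j f(1)])
    fix p' assume p': "p = Suc p'"
    have df: "S.d (*) p' f \<in> S.tc (sym_alg X) p' j"
      using S.d_in[OF S.graded_submodule_self] f(1) p' by blast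
    have "Poly_Mapping.map \<pi> (S.d (*) p' f) = 0"
      using z p' by (simp add: nat[symmetric] f(2) Z_def)
    then have "\<pi> (lookup (S.d (*) p' f) b) = 0" for b
      by (metis canonical_map_zero lookup_map lookup_zero)
    then show "S.d (*) p' f \<in> S.tc (variable_ideal X X) p' j"
      using shift_sumD[OF df] by (intro shift_sumI) (auto intro: kernel_in_variable_ideal)
  qed
  then obtain g where g: "g \<in> S.tc (sym_alg X) (Suc p) j" "f - S.d (*) p g \<in> S.tc (variable_ideal X X) p j"
    by blast
  show ?thesis
  proof (intro bexI[of _ "Poly_Mapping.map \<pi> g"] allI impI)
    show "Poly_Mapping.map \<pi> g \<in> chain_comp (Suc p) j"
      using shift_sumD[OF g(1)] canonical_map_component[OF variables_in_R] by (intro shift_sumI) (auto simp: lookup_map)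
    fix c assume c: "j - deg F p c \<le> 0"
    have "lookup (f - S.d (*) p g) c \<in> variable_ideal X X (j - deg F p c)"
      using graded_submodule_zero[OF S.graded_submodule_variable_ideal]
      by (intro shift_sum_lookup[OF g(2)])
    then have "lookup (f - S.d (*) p g) c = 0"
      using c by (rule variable_ideal_nonpositive)
    then have "lookup f c = lookup (S.d (*) p g) c"
      by (simp add: lookup_minus)
    moreover have "lookup z c = \<pi> (lookup f c)" by (simp add: f(2)[symmetric] lookup_map)
    ultimately show "lookup (z - chain_diff p (Poly_Mapping.map \<pi> g)) c = 0"
      by (simp add: nat lookup_minus lookup_map)
  qed
qed

text \<open>
  The premise \<open>inj\<close> is the injectivity of \<open>k \<otimes> Z\<^sub>p \<rightarrow> k \<otimes> C\<^sub>p\<close> in degree \<open>j\<close>. The representative \<open>y\<close> with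
  coordinates in \<open>R\<^sub>+\<close> is zero in \<open>k \<otimes> C\<^sub>p\<close>, so it lies in \<open>R\<^sub>+ Z\<^sub>p\<close>, which is contained in \<open>B\<^sub>p\<close>.
\<close>

lemma cycle_is_boundary:
  assumes z: "z \<in> Z p j" and j: "int p < j"
    and inj: "\<And>u. u \<in> G.tc (chain_comp p) (Suc 0) j \<Longrightarrow> G.d G.smul 0 u \<in> G.tc (Z p) 0 j \<Longrightarrow>
        \<exists>g\<in>G.tc (Z p) (Suc 0) j. G.d G.smul 0 g = G.d G.smul 0 u"
  shows "z \<in> B p j"
proof -
  obtain w where w: "w \<in> chain_comp (Suc p) j" "\<And>c. j - deg F p c \<le> 0 \<Longrightarrow> lookup (z - chain_diff p w) c = 0"
    using cycle_minimal_representative[OF z j] by blast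
  define y where "y = z - chain_diff p w"
  have bw: "chain_diff p w \<in> B p j" using w(1) by (simp add: B_def)
  have y: "y \<in> Z p j"
    unfolding y_def using z bw B_subset_Z by (intro graded_submodule_diff[OF graded_submodule_Z]) auto
  have yC: "y \<in> chain_comp p j" using y by (simp add: Z_def)
  \<comment> \<open>\<open>f = e \<otimes> y\<close> represents the class of \<open>y\<close> in \<open>k \<otimes> Z\<^sub>p\<close>.\<close>
  obtain e where e: "e \<in> G.tc R 0 0" "aug_map scale R G e = 1" using G.aug_map_surj by blast
  define f where "f = Poly_Mapping.map (\<lambda>a. G.smul a y) e"
  have lookup_f: "lookup f b = G.smul (lookup e b) y" for b by (simp add: f_def lookup_map)
  have f: "f \<in> G.tc (Z p) 0 j"
  proof (rule shift_sumI)
    fix b assume "b \<in> basis G 0"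
    then show "lookup f b \<in> Z p (j - deg G 0 b)"
      unfolding lookup_f
      using shift_sumD(2)[OF e(1)] y by (intro graded_submodule_act[OF graded_submodule_Z]) auto
  qed (simp add: lookup_f shift_sumD(3)[OF e(1)])
  have "\<exists>u\<in>G.tc (chain_comp p) (Suc 0) j. G.d G.smul 0 u = f"
  proof (rule G.boundary_of_coordinates)
    show "f \<in> G.tc (chain_comp p) 0 j"
      using f by (auto simp: shift_sum_def Z_def)
    fix c assume c: "c \<in> basis F p"
    let ?fc = "Poly_Mapping.map (\<lambda>v. lookup v c) f"
    have fc: "lookup ?fc b = lookup e b * lookup y c" for b
      by (simp add: lookup_map lookup_f)
    have "?fc \<in> G.tc R 0 (j - deg F p c)"
    proof (rule shift_sumI)
      fix b assume "b \<in> basis G 0"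
      from G.comp_times[OF shift_sumD(2)[OF e(1) this] shift_sumD(2)[OF yC c]]
      show "lookup ?fc b \<in> R (j - deg F p c - deg G 0 b)"
        unfolding fc by (simp add: algebra_simps)
    qed (simp add: fc shift_sumD(3)[OF e(1)])
    moreover have "aug_map scale R G ?fc = 0"
    proof (cases "j - deg F p c \<le> 0")
      case True
      then have "lookup y c = 0" using w(2) by (simp add: y_def)
      then have "?fc = 0" by (intro poly_mapping_eqI) (simp add: fc)
      then show ?thesis by (simp add: G.aug_map_eq)
    next
      case False
      with \<open>?fc \<in> _\<close> show ?thesis by (intro G.aug_map_nonzero_degree) auto
    qed
    ultimately have "?fc \<in> G.d (*) 0 ` G.tc R (Suc 0) (j - deg F p c)"
      unfolding G.aug_exact[symmetric] by simp
    then show "\<exists>g\<in>G.tc R (Suc 0) (j - deg F p c). G.d (*) 0 g = ?fc" by auto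
  qed
  then obtain u where u: "u \<in> G.tc (chain_comp p) (Suc 0) j" "G.d G.smul 0 u = f" by blast
  then obtain g where g: "g \<in> G.tc (Z p) (Suc 0) j" "G.d G.smul 0 g = f" using inj f by auto
  have "y \<in> B p j"
  proof (rule D.augmented_boundary[OF graded_submodule_Z graded_submodule_B _ y e g(1)])
    show "G.d G.smul 0 g = Poly_Mapping.map (\<lambda>a. G.smul a y) e" by (simp add: g(2) f_def)
  qed (rule positive_part_kills_homology)
  from graded_submodule_add[OF graded_submodule_B this bw] show ?thesis by (simp add: y_def)
qed

text \<open>
  Only \<open>Tor\<^sub>m(k, Z\<^sub>p)\<close> with \<open>m > 0\<close> is bounded: as \<open>F\<close> may have superfluous basis elements of any degree,
  there is no such bound for \<open>m = 0\<close>.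
\<close>

definition tor_cycles_bound :: "nat \<Rightarrow> nat \<Rightarrow> bool" where
  "tor_cycles_bound n p \<longleftrightarrow> (\<forall>m j f. Suc m + p \<le> n \<longrightarrow> int (2 * p + Suc m) < j \<longrightarrow>
     f \<in> G.tc (Z p) (Suc m) j \<longrightarrow> G.d G.smul m f = 0 \<longrightarrow>
       (\<exists>g\<in>G.tc (Z p) (Suc (Suc m)) j. G.d G.smul (Suc m) g = f))"

definition homology_bound :: "nat \<Rightarrow> bool" where
  "homology_bound p \<longleftrightarrow> (\<forall>j. int (2 * p) < j \<longrightarrow> Z p j \<subseteq> B p j)"

context
  fixes n :: nat
  assumes residue: "\<And>m l. m \<le> n + 1 \<Longrightarrow> int m < l \<Longrightarrow>
      cycles G (residue_field scale R) m l \<subseteq> boundaries G (residue_field scale R) m l"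
begin

lemma tor_boundaries_bound:
  assumes "tor_cycles_bound n p" "homology_bound p"
    and m: "Suc m + p \<le> n" and j: "int (2 * p + m + 2) < j"
    and f: "f \<in> G.tc (B p) (Suc m) j" "G.d G.smul m f = 0"
  shows "\<exists>g\<in>G.tc (B p) (Suc (Suc m)) j. G.d G.smul (Suc m) g = f"
proof (rule D.submodule_tor_vanishes[OF graded_submodule_Z graded_submodule_B B_subset_Z _ _ f])
  fix f assume "f \<in> G.tc (Z p) (Suc m) j" "G.d G.smul m f = 0"
  then show "\<exists>g\<in>G.tc (Z p) (Suc (Suc m)) j. G.d G.smul (Suc m) g = f"
    using assms(1) m j unfolding tor_cycles_bound_def by simp
next
  fix f assume f: "f \<in> G.tc (Z p) (Suc (Suc m)) j" "G.d G.smul (Suc m) f \<in> G.tc (B p) (Suc m) j"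
  show "\<exists>g\<in>G.tc (Z p) (Suc (Suc (Suc m))) j. f - G.d G.smul (Suc (Suc m)) g \<in> G.tc (B p) (Suc (Suc m)) j"
  proof (rule D.quotient_tor_vanishes[OF graded_submodule_Z graded_submodule_B B_subset_Z
        positive_part_kills_homology _ _ _ f])
    show "Z p l \<subseteq> B p l" if "int (2 * p) < l" for l
      using assms(2) that by (simp add: homology_bound_def)
  qed (use residue m j in auto)
qed

text \<open>
  For positive \<open>m\<close>, this gives the bound on \<open>Tor\<^sub>m(k, Z\<^sub>p\<^sub>+\<^sub>1)\<close>, because \<open>C\<^sub>p\<^sub>+\<^sub>1\<close> is free; for \<open>m = 0\<close>, it is
  the injectivity that \<open>cycle_is_boundary\<close> requires.
\<close>

lemma cycles_lift:
  assumes "tor_cycles_bound n p" "homology_bound p"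
    and m: "Suc m + p \<le> n" and j: "int (2 * p + m + 2) < j"
    and u: "u \<in> G.tc (chain_comp (Suc p)) (Suc m) j" "G.d G.smul m u \<in> G.tc (Z (Suc p)) m j"
  shows "\<exists>g\<in>G.tc (Z (Suc p)) (Suc m) j. G.d G.smul m g = G.d G.smul m u"
  unfolding Z_Suc
proof (rule D.kernel_boundary[OF D.N.module_axioms graded_submodule_chain_comp C.N.additive_lin_ext chain_diff_smul _ _ u(1)])
  show "B p l = chain_diff p ` chain_comp (Suc p) l" for l by (simp add: B_def)
  fix v assume "v \<in> G.tc (B p) (Suc m) j" "G.d G.smul m v = 0"
  then show "\<exists>w\<in>G.tc (B p) (Suc (Suc m)) j. G.d G.smul (Suc m) w = v"
    using tor_boundaries_bound[OF assms(1-4)] by blast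
next
  have "chain_diff p (lookup (G.d G.smul m u) b) = 0" for b
    using shift_sum_lookup[OF u(2) graded_submodule_zero[OF graded_submodule_Z], of b] by (simp add: Z_Suc)
  then show "Poly_Mapping.map (chain_diff p) (G.d G.smul m u) = 0"
    by (intro poly_mapping_eqI) (simp add: lookup_map)
qed

lemma tor_cycles_and_homology_bound: "p \<le> n \<Longrightarrow> tor_cycles_bound n p \<and> homology_bound p"
proof (induction p)
  case 0
  have "tor_cycles_bound n 0"
    unfolding tor_cycles_bound_def Z_0 by (auto intro!: G.free_tor_vanishes)
  moreover have "homology_bound 0"
    unfolding homology_bound_def
  proof (intro allI impI subsetI)
    fix j z assume "int (2 * 0) < j" "z \<in> Z 0 j"
    then show "z \<in> B 0 j" by (intro cycle_is_boundary) (auto simp: Z_0)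
  qed
  ultimately show ?case ..
next
  case (Suc p)
  then have IH: "tor_cycles_bound n p" "homology_bound p" by auto
  have "tor_cycles_bound n (Suc p)"
    unfolding tor_cycles_bound_def
  proof (intro allI impI)
    fix m j f assume m: "Suc m + Suc p \<le> n" and j: "int (2 * Suc p + Suc m) < j"
      and f: "f \<in> G.tc (Z (Suc p)) (Suc m) j" "G.d G.smul m f = 0"
    have "f \<in> G.tc (chain_comp (Suc p)) (Suc m) j"
      using f(1) by (auto simp: shift_sum_def Z_def)
    then obtain u where u: "u \<in> G.tc (chain_comp (Suc p)) (Suc (Suc m)) j" "G.d G.smul (Suc m) u = f"
      using G.free_tor_vanishes f(2) by blast
    have "\<exists>g\<in>G.tc (Z (Suc p)) (Suc (Suc m)) j. G.d G.smul (Suc m) g = G.d G.smul (Suc m) u"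
      by (rule cycles_lift[OF IH _ _ u(1)]) (use m j f(1) u(2) in auto)
    then show "\<exists>g\<in>G.tc (Z (Suc p)) (Suc (Suc m)) j. G.d G.smul (Suc m) g = f"
      by (simp add: u(2))
  qed
  moreover have "homology_bound (Suc p)"
    unfolding homology_bound_def
  proof (intro allI impI subsetI)
    fix j z assume j: "int (2 * Suc p) < j" and z: "z \<in> Z (Suc p) j"
    show "z \<in> B (Suc p) j"
    proof (rule cycle_is_boundary[OF z])
      show "int (Suc p) < j" using j by simp
      fix u assume "u \<in> G.tc (chain_comp (Suc p)) (Suc 0) j" "G.d G.smul 0 u \<in> G.tc (Z (Suc p)) 0 j"
      then show "\<exists>g\<in>G.tc (Z (Suc p)) (Suc 0) j. G.d G.smul 0 g = G.d G.smul 0 u"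
        by (intro cycles_lift[OF IH]) (use Suc.prems j in auto)
    qed
  qed
  ultimately show ?case ..
qed

end

end

section \<open>From vanishing homology to the bound on Tor\<close>

lemma trivial_quotientD:
  assumes "carrier (additive_group Z Mod B) = {one (additive_group Z Mod B)}" "0 \<in> B"
  shows "Z \<subseteq> B"
proof
  fix z assume "z \<in> Z"
  then have "B #>\<^bsub>additive_group Z\<^esub> z \<in> carrier (additive_group Z Mod B)"
    by (auto simp: FactGroup_def RCOSETS_def additive_group_def)
  then have "B #>\<^bsub>additive_group Z\<^esub> z = B" using assms(1) by (simp add: FactGroup_def)
  moreover have "0 + z \<in> B #>\<^bsub>additive_group Z\<^esub> z"
    using assms(2) by (auto simp: r_coset_def additive_group_def)
  ultimately show "z \<in> B" by simp
qed

lemma trivial_quotientI: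
  assumes "Z \<subseteq> B" "0 \<in> Z" "\<And>u v. u \<in> B \<Longrightarrow> v \<in> B \<Longrightarrow> u - v \<in> B"
  shows "carrier (additive_group Z Mod B) = {one (additive_group Z Mod B)}"
proof -
  have "B #>\<^bsub>additive_group Z\<^esub> z = B" if "z \<in> Z" for z
  proof (intro equalityI subsetI)
    have z: "z \<in> B" "- z \<in> B" using that assms(1,2) assms(3)[of 0 z] by auto
    fix x
    show "x \<in> B" if "x \<in> B #>\<^bsub>additive_group Z\<^esub> z"
      using that z assms(3)[of _ "- z"] by (auto simp: r_coset_def additive_group_def)
    show "x \<in> B #>\<^bsub>additive_group Z\<^esub> z" if "x \<in> B"
      using assms(3)[OF that z(1)] by (force simp: r_coset_def additive_group_def)
  qed
  then show ?thesis
    using assms(2) by (auto simp: FactGroup_def RCOSETS_def additive_group_def)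
qed

theorem corollary4p2:
  fixes scale :: "'k::field \<Rightarrow> 'r::comm_ring_1 \<Rightarrow> 'r"
    and R :: "int \<Rightarrow> 'r set"
    and X :: "'r set"
    and n :: nat
  assumes "standard_graded_algebra scale R"
    and "\<not> module.dependent scale X"
    and "module.span scale X = R 1"
    and "reg_upto scale R (n + 1) (residue_field scale R) = 0"
  shows "\<forall>i\<le>n. t_deg sym_scale (sym_alg X :: int \<Rightarrow> ('r, 'k) pol set) (sym_module scale R) i
                \<le> ereal (real (2 * i))"
proof (intro allI impI)
  fix i assume i: "i \<le> n"
  interpret R: standard_graded_algebra scale R by fact
  obtain X' where "finite X'" "R.span X' = R 1" using R.finite_rank by blast
  then have X: "finite X"
    using R.independent_span_bound[of X' X] assms(2,3) R.span_superset by auto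
  interpret R: connected_algebra scale R using R.standard_graded_connected X assms(3) by blast
  interpret S: connected_algebra sym_scale "sym_alg X :: int \<Rightarrow> ('r, 'k) pol set"
    using X by (rule connected_sym_alg)
  define F where "F = (SOME F. is_free_resolution sym_scale (sym_alg X :: int \<Rightarrow> ('r, 'k) pol set) F)"
  define G where "G = (SOME G. is_free_resolution scale R G)"
  have F: "is_free_resolution sym_scale (sym_alg X :: int \<Rightarrow> ('r, 'k) pol set) F"
    unfolding F_def using S.free_resolution_exists by (rule someI_ex)
  have G: "is_free_resolution scale R G"
    unfolding G_def using R.free_resolution_exists by (rule someI_ex)
  interpret resolved_standard_algebra scale R X F G
    using X assms(3) F G
    by unfold_locales
  have Tor_R: "Tor scale R N m l = additive_group (cycles G N m l) Mod boundaries G N m l"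
    for N :: "('r, 'k) graded_module" and m l
    by (simp add: Tor_def G_def Let_def)
  have residue: "cycles G (residue_field scale R) m l \<subseteq> boundaries G (residue_field scale R) m l"
    if m: "m \<le> n + 1" and l: "int m < l" for m l
  proof (rule trivial_quotientD)
    have "t_deg scale R (residue_field scale R) m - ereal (real m) \<le> reg_upto scale R (n + 1) (residue_field scale R)"
      unfolding reg_upto_def using m by (intro Max_ge) auto
    then have "t_deg scale R (residue_field scale R) m \<le> ereal (real m)"
      using assms(4) by (simp add: ereal_minus_le_iff)
    also have "\<dots> < ereal (real_of_int l)" using l by simp
    finally have lt: "t_deg scale R (residue_field scale R) m < ereal (real_of_int l)" .
    show "carrier (additive_group (cycles G (residue_field scale R) m l) Mod boundaries G (residue_field scale R) m l)
        = {one (additive_group (cycles G (residue_field scale R) m l) Mod boundaries G (residue_field scale R) m l)}"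
    proof (rule ccontr)
      assume "\<not> ?thesis"
      then have "ereal (real_of_int l) \<le> t_deg scale R (residue_field scale R) m"
        unfolding t_deg_def top_degree_def by (intro SUP_upper) (simp add: Tor_R)
      with lt show False by simp
    qed
    have "0 \<in> tensor_comp G (residue_field scale R) (Suc m) l"
      by (simp add: tensor_comp_def residue_field_def)
    moreover have "tensor_diff G (residue_field scale R) m 0 = 0"
      by (simp add: tensor_diff_def)
    ultimately show "0 \<in> boundaries G (residue_field scale R) m l"
      unfolding boundaries_def by (metis imageI)
  qed
  have M: "comp (sym_module scale R) = R" "act (sym_module scale R) = canonical_act"
    by (simp_all add: sym_module_def)
  have cyc: "cycles F (sym_module scale R) i j = Z i j" for j
    by (auto simp: cycles_def Z_def tensor_comp_eq_shift_sum tensor_diff_eq_lin_ext M split: nat.split)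
  have bnd: "boundaries F (sym_module scale R) i j = B i j" for j
    by (simp add: boundaries_def B_def tensor_comp_eq_shift_sum tensor_diff_eq_lin_ext M)
  show "t_deg sym_scale (sym_alg X :: int \<Rightarrow> ('r, 'k) pol set) (sym_module scale R) i \<le> ereal (real (2 * i))"
    unfolding t_deg_def top_degree_def
  proof (rule SUP_least)
    fix j assume j: "j \<in> {j. carrier (Tor sym_scale (sym_alg X :: int \<Rightarrow> ('r, 'k) pol set) (sym_module scale R) i j)
        \<noteq> {one (Tor sym_scale (sym_alg X :: int \<Rightarrow> ('r, 'k) pol set) (sym_module scale R) i j)}}"
    have "\<not> int (2 * i) < j"
    proof
      assume "int (2 * i) < j"
      then have "Z i j \<subseteq> B i j" using tor_cycles_and_homology_bound[OF residue i] by (simp add: homology_bound_def)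
      then have "carrier (additive_group (Z i j) Mod B i j) = {one (additive_group (Z i j) Mod B i j)}"
        by (rule trivial_quotientI)
          (simp_all add: graded_submodule_zero[OF graded_submodule_Z] graded_submodule_diff[OF graded_submodule_B])
      then show False using j by (simp add: Tor_def cyc bnd flip: F_def)
    qed
    then show "ereal (real_of_int j) \<le> ereal (real (2 * i))" by simp
  qed
qed

end
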